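(* Let $(M,\varphi,\xi,\eta,g)$ be a $(2n+1)$-dimensional $K$-contact manifold equipped with its semi-symmetric non-metric (SSNM) connection $\tilde\nabla$, and let $r$ be the scalar curvature of the Levi-Civita connection. Suppose that $M$ admits a conformal $\eta$-Ricci-Yamabe soliton with respect to $\tilde\nabla$, with potential vector field $V$ and data $\lambda,\alpha,\beta,\gamma,p$, and that $V$ is a torse-forming vector field with respect to $\tilde\nabla$, with smooth function $\mu$ and generating 1-form $\psi$. Then $$\lambda=\gamma-\mu-\psi(\xi)\eta(V)-4n\alpha+\frac12\left[\beta(r+2n)+\left(p+\frac{2}{2n+1}\right)\right],$$ and the soliton is shrinking if $\gamma+\frac12\left[\beta(r+2n)+\left(p+\frac{2}{2n+1}\right)\right]<\mu+\psi(\xi)\eta(V)+4n\alpha$, steady if $\gamma+\frac12\left[\beta(r+2n)+\left(p+\frac{2}{2n+1}\right)\right]=\mu+\psi(\xi)\eta(V)+4n\alpha$, and expanding if $\gamma+\frac12\left[\beta(r+2n)+\left(p+\frac{2}{2n+1}\right)\right]>\mu+\psi(\xi)\eta(V)+4n\alpha$.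
   Context: A $K$-contact manifold $(M^{2n+1},\varphi,\xi,\eta,g)$ consists of a Riemannian manifold $(M,g)$, a $(1,1)$-tensor $\varphi$, a vector field $\xi$ and a 1-form $\eta$ with $\varphi^2=-I+\eta\otimes\xi$, $\eta(\xi)=1$, $g(\varphi X,\varphi Y)=g(X,Y)-\eta(X)\eta(Y)$ (so $\eta(X)=g(X,\xi)$, $\varphi\xi=0$, $\eta\circ\varphi=0$), $d\eta(X,Y)=g(X,\varphi Y)$, and $\xi$ Killing; the conventions are such that $\nabla_X\xi=-\varphi X$, where $\nabla$ is the Levi-Civita connection. The SSNM connection is $\tilde\nabla_XY=\nabla_XY+\eta(Y)X$; its torsion is $\tilde T(X,Y)=\eta(Y)X-\eta(X)Y$. Its curvature is $\tilde R(X,Y)Z=\tilde\nabla_X\tilde\nabla_YZ-\tilde\nabla_Y\tilde\nabla_XZ-\tilde\nabla_{[X,Y]}Z$; its Ricci tensor is $\tilde S(Y,Z)=\operatorname{trace}\{X\mapsto\tilde R(X,Y)Z\}$; its scalar curvature $\tilde r$ is the $g$-trace of $\tilde S$. Lie derivative with respect to $\tilde\nabla$: $\tilde{\mathcal L}_VX=\tilde\nabla_VX-\tilde\nabla_XV-\tilde T(V,X)$ and $(\tilde{\mathcal L}_Vg)(X,Y)=V(g(X,Y))-g(\tilde{\mathcal L}_VX,Y)-g(X,\tilde{\mathcal L}_VY)$. A vector field $V$ is torse-forming with respect to $\tilde\nabla$ if $\tilde\nabla_XV=\mu X+\psi(X)V+\eta(V)X$ for all $X$, where $\mu$ is a smooth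 function and $\psi$ a 1-form (the generating form). A conformal $\eta$-Ricci-Yamabe soliton with respect to $\tilde\nabla$ on $M^{2n+1}$ is given by a vector field $V$, a real number $\lambda$, real scalars $\alpha,\beta$, a constant $\gamma$ and a scalar field $p$ (conformal pressure) with $\tilde{\mathcal L}_Vg+2\alpha\tilde S+\left[2\lambda-\beta\tilde r-\left(p+\frac{2}{2n+1}\right)\right]g+2\gamma\,\eta\otimes\eta=0$. It is expanding, steady or shrinking according as $\lambda>0$, $\lambda=0$ or $\lambda<0$. *)

theory Defs
  imports "HOL-Analysis.Analysis" "HOL-Library.Function_Algebras"
begin

text \<open>
  Tangent vectors are derivations, i.e. functions \<open>('a \<Rightarrow> real) \<Rightarrow> real\<close>, with the pointwise vector
  space structure. The instance below makes the library notions \<open>span\<close>, \<open>independent\<close> and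
  \<open>representation\<close> available for them.
\<close>

instantiation "fun" :: (type, real_vector) real_vector
begin

definition scaleR_fun :: "real \<Rightarrow> ('a \<Rightarrow> 'b) \<Rightarrow> 'a \<Rightarrow> 'b"
  where "scaleR_fun c f = (\<lambda>x. c *\<^sub>R f x)"

instance
  by standard (auto simp: scaleR_fun_def fun_eq_iff scaleR_add_right scaleR_add_left)

end


section \<open>Smooth manifolds\<close>

text \<open>\<open>C\<^sup>k\<close> and \<open>C\<^sup>\<infinity>\<close> maps on an open set, by iterated directional derivatives.\<close>

primrec Ck_on :: "nat \<Rightarrow> 'e::euclidean_space set \<Rightarrow> ('e \<Rightarrow> 'f::real_normed_vector) \<Rightarrow> bool" where
  "Ck_on 0 S f \<longleftrightarrow> continuous_on S f"
| "Ck_on (Suc k) S f \<longleftrightarrow>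
     (\<forall>x\<in>S. f differentiable (at x)) \<and> (\<forall>v. Ck_on k S (\<lambda>x. frechet_derivative f (at x) v))"

definition smooth_on :: "'e::euclidean_space set \<Rightarrow> ('e \<Rightarrow> 'f::real_normed_vector) \<Rightarrow> bool"
  where "smooth_on S f \<longleftrightarrow> (\<forall>k. Ck_on k S f)"

text \<open>
  The manifold is the whole type \<open>'a\<close>, whose topology is Hausdorff and second countable by its
  type class. A chart is a pair of its domain and the coordinate map.
\<close>

type_synonym ('a, 'e) chart = "'a set \<times> ('a \<Rightarrow> 'e)"

definition is_chart :: "('a::topological_space, 'e::euclidean_space) chart \<Rightarrow> bool" where
  "is_chart = (\<lambda>(U, c). open U \<and> open (c ` U) \<and> homeomorphism U (c ` U) c (inv_into U c))"

definition smooth_manifold ::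
  "('a::{t2_space,second_countable_topology}, 'e::euclidean_space) chart set \<Rightarrow> nat \<Rightarrow> bool" where
  "smooth_manifold A m \<longleftrightarrow>
     DIM('e) = m \<and>
     (\<forall>C\<in>A. is_chart C) \<and>
     (\<Union>C\<in>A. fst C) = UNIV \<and>
     (\<forall>(U, c)\<in>A. \<forall>(W, d)\<in>A. smooth_on (c ` (U \<inter> W)) (d \<circ> inv_into U c))"

definition smooth_fun :: "('a, 'e::euclidean_space) chart set \<Rightarrow> ('a \<Rightarrow> real) \<Rightarrow> bool" where
  "smooth_fun A f \<longleftrightarrow> (\<forall>(U, c)\<in>A. smooth_on (c ` U) (f \<circ> inv_into U c))"


section \<open>Tangent vectors and tensor fields\<close>

type_synonym 'a tvec = "('a \<Rightarrow> real) \<Rightarrow> real"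
type_synonym 'a vfield = "'a \<Rightarrow> 'a tvec"
type_synonym 'a one_form = "'a \<Rightarrow> 'a tvec \<Rightarrow> real"
type_synonym 'a endo_field = "'a \<Rightarrow> 'a tvec \<Rightarrow> 'a tvec"
type_synonym 'a bilin_field = "'a \<Rightarrow> 'a tvec \<Rightarrow> 'a tvec \<Rightarrow> real"
type_synonym 'a connection = "'a vfield \<Rightarrow> 'a vfield \<Rightarrow> 'a vfield"

text \<open>
  Derivations of \<open>C\<^sup>\<infinity>(M)\<close> at \<open>x\<close>. As HOL functions are total, a tangent vector is required to
  vanish on non-smooth arguments, so that it is determined by its action on \<open>C\<^sup>\<infinity>(M)\<close>.
\<close>

definition tangent_space :: "('a, 'e::euclidean_space) chart set \<Rightarrow> 'a \<Rightarrow> 'a tvec set" where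
  "tangent_space A x = {v.
     (\<forall>f. \<not> smooth_fun A f \<longrightarrow> v f = 0) \<and>
     (\<forall>f h. smooth_fun A f \<longrightarrow> smooth_fun A h \<longrightarrow>
        v (\<lambda>y. f y + h y) = v f + v h \<and>
        v (\<lambda>y. f y * h y) = f x * v h + h x * v f) \<and>
     (\<forall>f c. smooth_fun A f \<longrightarrow> v (\<lambda>y. c * f y) = c * v f)}"

definition vector_fields :: "('a, 'e::euclidean_space) chart set \<Rightarrow> 'a vfield set" where
  "vector_fields A = {X.
     (\<forall>x. X x \<in> tangent_space A x) \<and>
     (\<forall>f. smooth_fun A f \<longrightarrow> smooth_fun A (\<lambda>x. X x f))}"

definition fmul :: "('a \<Rightarrow> real) \<Rightarrow> 'a vfield \<Rightarrow> 'a vfield"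
  where "fmul f X = (\<lambda>x. f x *\<^sub>R X x)"

definition bracket :: "'a vfield \<Rightarrow> 'a vfield \<Rightarrow> 'a vfield"
  where "bracket X Y = (\<lambda>x f. X x (\<lambda>y. Y y f) - Y x (\<lambda>y. X y f))"

definition linear_on_set :: "'v::real_vector set \<Rightarrow> ('v \<Rightarrow> 'w::real_vector) \<Rightarrow> bool" where
  "linear_on_set S f \<longleftrightarrow>
     (\<forall>u\<in>S. \<forall>v\<in>S. f (u + v) = f u + f v) \<and> (\<forall>c. \<forall>u\<in>S. f (c *\<^sub>R u) = c *\<^sub>R f u)"

definition is_one_form :: "('a, 'e::euclidean_space) chart set \<Rightarrow> 'a one_form \<Rightarrow> bool" where
  "is_one_form A \<omega> \<longleftrightarrow>
     (\<forall>x. linear_on_set (tangent_space A x) (\<omega> x)) \<and>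
     (\<forall>X\<in>vector_fields A. smooth_fun A (\<lambda>x. \<omega> x (X x)))"

definition is_endo_field :: "('a, 'e::euclidean_space) chart set \<Rightarrow> 'a endo_field \<Rightarrow> bool" where
  "is_endo_field A F \<longleftrightarrow>
     (\<forall>x. F x ` tangent_space A x \<subseteq> tangent_space A x \<and> linear_on_set (tangent_space A x) (F x)) \<and>
     (\<forall>X\<in>vector_fields A. (\<lambda>x. F x (X x)) \<in> vector_fields A)"

definition riemannian_metric :: "('a, 'e::euclidean_space) chart set \<Rightarrow> 'a bilin_field \<Rightarrow> bool" where
  "riemannian_metric A g \<longleftrightarrow>
     (\<forall>x. \<forall>u\<in>tangent_space A x.
        linear_on_set (tangent_space A x) (g x u) \<and>
        (\<forall>v\<in>tangent_space A x. g x u v = g x v u) \<and>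
        (u \<noteq> 0 \<longrightarrow> g x u u > 0)) \<and>
     (\<forall>X\<in>vector_fields A. \<forall>Y\<in>vector_fields A. smooth_fun A (\<lambda>x. g x (X x) (Y x)))"


section \<open>Connections and curvature\<close>

definition affine_connection :: "('a, 'e::euclidean_space) chart set \<Rightarrow> 'a connection \<Rightarrow> bool" where
  "affine_connection A D \<longleftrightarrow>
     (\<forall>X\<in>vector_fields A. \<forall>Y\<in>vector_fields A.
        D X Y \<in> vector_fields A \<and>
        (\<forall>Z\<in>vector_fields A. D (X + Z) Y = D X Y + D Z Y \<and> D X (Y + Z) = D X Y + D X Z) \<and>
        (\<forall>f. smooth_fun A f \<longrightarrow>
           D (fmul f X) Y = fmul f (D X Y) \<and>
           D X (fmul f Y) = fmul f (D X Y) + fmul (\<lambda>x. X x f) Y))"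

definition torsion :: "'a connection \<Rightarrow> 'a vfield \<Rightarrow> 'a vfield \<Rightarrow> 'a vfield"
  where "torsion D X Y = D X Y - D Y X - bracket X Y"

definition levi_civita ::
  "('a, 'e::euclidean_space) chart set \<Rightarrow> 'a bilin_field \<Rightarrow> 'a connection \<Rightarrow> bool" where
  "levi_civita A g D \<longleftrightarrow>
     affine_connection A D \<and>
     (\<forall>X\<in>vector_fields A. \<forall>Y\<in>vector_fields A. torsion D X Y = 0) \<and>
     (\<forall>X\<in>vector_fields A. \<forall>Y\<in>vector_fields A. \<forall>Z\<in>vector_fields A. \<forall>x.
        X x (\<lambda>y. g y (Y y) (Z y)) = g x (D X Y x) (Z x) + g x (Y x) (D X Z x))"

definition curvature :: "'a connection \<Rightarrow> 'a vfield \<Rightarrow> 'a vfield \<Rightarrow> 'a vfield \<Rightarrow> 'a vfield"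
  where "curvature D X Y Z = D X (D Y Z) - D Y (D X Z) - D (bracket X Y) Z"

text \<open>
  Curvature is tensorial, so its value on tangent vectors at \<open>x\<close> is computed from arbitrary
  vector fields extending them.
\<close>

definition extend_vec :: "('a, 'e::euclidean_space) chart set \<Rightarrow> 'a \<Rightarrow> 'a tvec \<Rightarrow> 'a vfield"
  where "extend_vec A x u = (SOME X. X \<in> vector_fields A \<and> X x = u)"

definition curvature_at ::
  "('a, 'e::euclidean_space) chart set \<Rightarrow> 'a connection \<Rightarrow>
    'a \<Rightarrow> 'a tvec \<Rightarrow> 'a tvec \<Rightarrow> 'a tvec \<Rightarrow> 'a tvec" where
  "curvature_at A D x u v w =
     curvature D (extend_vec A x u) (extend_vec A x v) (extend_vec A x w) x"

text \<open>Trace of an endomorphism \<open>F\<close> of a finite-dimensional subspace \<open>S\<close>, in any basis of \<open>S\<close>.\<close>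

definition trace_on :: "'v::real_vector set \<Rightarrow> ('v \<Rightarrow> 'v) \<Rightarrow> real" where
  "trace_on S F =
     (let B = (SOME B. independent B \<and> span B = S) in \<Sum>b\<in>B. representation B (F b) b)"

text \<open>Trace of a bilinear form with respect to an inner product \<open>h\<close> on \<open>S\<close>, in any
  \<open>h\<close>-orthonormal basis of \<open>S\<close>.\<close>

definition metric_trace_on ::
  "'v::real_vector set \<Rightarrow> ('v \<Rightarrow> 'v \<Rightarrow> real) \<Rightarrow> ('v \<Rightarrow> 'v \<Rightarrow> real) \<Rightarrow> real" where
  "metric_trace_on S h b =
     (let B = (SOME B. independent B \<and> span B = S \<and>
                       (\<forall>u\<in>B. \<forall>v\<in>B. h u v = (if u = v then 1 else 0)))
      in \<Sum>e\<in>B. b e e)"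

definition ricci :: "('a, 'e::euclidean_space) chart set \<Rightarrow> 'a connection \<Rightarrow> 'a bilin_field" where
  "ricci A D = (\<lambda>x v w. trace_on (tangent_space A x) (\<lambda>u. curvature_at A D x u v w))"

definition scalar_curvature ::
  "('a, 'e::euclidean_space) chart set \<Rightarrow> 'a bilin_field \<Rightarrow> 'a connection \<Rightarrow> 'a \<Rightarrow> real" where
  "scalar_curvature A g D x = metric_trace_on (tangent_space A x) (g x) (ricci A D x)"


section \<open>\<open>K\<close>-contact manifolds\<close>

text \<open>
  The factor \<open>1/2\<close> is the convention under which \<open>d\<eta>(X,Y) = g(X, \<phi>Y)\<close> gives
  \<open>\<nabla>\<^sub>X \<xi> = - \<phi>X\<close>; without it one would get \<open>\<nabla>\<^sub>X \<xi> = - \<phi>X / 2\<close>.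
\<close>

definition ext_deriv :: "'a one_form \<Rightarrow> 'a vfield \<Rightarrow> 'a vfield \<Rightarrow> 'a \<Rightarrow> real" where
  "ext_deriv \<omega> X Y x =
     (X x (\<lambda>y. \<omega> y (Y y)) - Y x (\<lambda>y. \<omega> y (X y)) - \<omega> x (bracket X Y x)) / 2"

definition killing :: "('a, 'e::euclidean_space) chart set \<Rightarrow> 'a bilin_field \<Rightarrow> 'a vfield \<Rightarrow> bool" where
  "killing A g K \<longleftrightarrow>
     K \<in> vector_fields A \<and>
     (\<forall>X\<in>vector_fields A. \<forall>Y\<in>vector_fields A. \<forall>x.
        K x (\<lambda>y. g y (X y) (Y y)) - g x (bracket K X x) (Y x) - g x (X x) (bracket K Y x) = 0)"

text \<open>As usual for contact manifolds of dimension \<open>2n+1\<close>, \<open>n \<ge> 1\<close>.\<close>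

definition K_contact_manifold ::
  "('a::{t2_space,second_countable_topology}, 'e::euclidean_space) chart set \<Rightarrow> nat \<Rightarrow>
    'a endo_field \<Rightarrow> 'a vfield \<Rightarrow> 'a one_form \<Rightarrow> 'a bilin_field \<Rightarrow> bool" where
  "K_contact_manifold A n \<phi> \<xi> \<eta> g \<longleftrightarrow>
     n \<ge> 1 \<and>
     smooth_manifold A (2 * n + 1) \<and>
     riemannian_metric A g \<and>
     is_endo_field A \<phi> \<and>
     \<xi> \<in> vector_fields A \<and>
     is_one_form A \<eta> \<and>
     (\<forall>x. \<forall>u\<in>tangent_space A x. \<phi> x (\<phi> x u) = - u + \<eta> x u *\<^sub>R \<xi> x) \<and>
     (\<forall>x. \<eta> x (\<xi> x) = 1) \<and>
     (\<forall>x. \<forall>u\<in>tangent_space A x. \<forall>v\<in>tangent_space A x.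
        g x (\<phi> x u) (\<phi> x v) = g x u v - \<eta> x u * \<eta> x v) \<and>
     (\<forall>X\<in>vector_fields A. \<forall>Y\<in>vector_fields A. \<forall>x.
        ext_deriv \<eta> X Y x = g x (X x) (\<phi> x (Y x))) \<and>
     killing A g \<xi>"


section \<open>The semi-symmetric non-metric connection and solitons\<close>

definition SSNM :: "'a one_form \<Rightarrow> 'a connection \<Rightarrow> 'a connection"
  where "SSNM \<eta> D = (\<lambda>X Y. D X Y + fmul (\<lambda>x. \<eta> x (Y x)) X)"

definition lie_field :: "'a connection \<Rightarrow> 'a vfield \<Rightarrow> 'a vfield \<Rightarrow> 'a vfield"
  where "lie_field D V X = D V X - D X V - torsion D V X"

definition lie_metric ::
  "'a connection \<Rightarrow> 'a bilin_field \<Rightarrow> 'a vfield \<Rightarrow> 'a vfield \<Rightarrow> 'a vfield \<Rightarrow> 'a \<Rightarrow> real" where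
  "lie_metric D g V X Y x =
     V x (\<lambda>y. g y (X y) (Y y)) - g x (lie_field D V X x) (Y x) - g x (X x) (lie_field D V Y x)"

definition torse_forming ::
  "('a, 'e::euclidean_space) chart set \<Rightarrow> 'a one_form \<Rightarrow> 'a connection \<Rightarrow> 'a vfield \<Rightarrow>
    ('a \<Rightarrow> real) \<Rightarrow> 'a one_form \<Rightarrow> bool" where
  "torse_forming A \<eta> D V \<mu> \<psi> \<longleftrightarrow>
     V \<in> vector_fields A \<and> smooth_fun A \<mu> \<and> is_one_form A \<psi> \<and>
     (\<forall>X\<in>vector_fields A.
        D X V = fmul \<mu> X + fmul (\<lambda>x. \<psi> x (X x)) V + fmul (\<lambda>x. \<eta> x (V x)) X)"

definition conformal_eta_Ricci_Yamabe_soliton ::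
  "('a, 'e::euclidean_space) chart set \<Rightarrow> nat \<Rightarrow> 'a bilin_field \<Rightarrow> 'a one_form \<Rightarrow> 'a connection \<Rightarrow>
    'a vfield \<Rightarrow> real \<Rightarrow> real \<Rightarrow> real \<Rightarrow> real \<Rightarrow> ('a \<Rightarrow> real) \<Rightarrow> bool" where
  "conformal_eta_Ricci_Yamabe_soliton A n g \<eta> D V lam \<alpha> \<beta> \<gamma> p \<longleftrightarrow>
     V \<in> vector_fields A \<and> smooth_fun A p \<and>
     (\<forall>X\<in>vector_fields A. \<forall>Y\<in>vector_fields A. \<forall>x.
        lie_metric D g V X Y x + 2 * \<alpha> * ricci A D x (X x) (Y x)
        + (2 * lam - \<beta> * scalar_curvature A g D x - (p x + 2 / (2 * real n + 1))) * g x (X x) (Y x)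
        + 2 * \<gamma> * (\<eta> x (X x) * \<eta> x (Y x)) = 0)"

definition expanding :: "real \<Rightarrow> bool" where "expanding lam \<longleftrightarrow> lam > 0"
definition steady :: "real \<Rightarrow> bool" where "steady lam \<longleftrightarrow> lam = 0"
definition shrinking :: "real \<Rightarrow> bool" where "shrinking lam \<longleftrightarrow> lam < 0"

end

theory Submission
  imports Defs
begin

text \<open>
  The soliton data are forced to be degenerate: \<open>\<alpha> = 0\<close>, \<open>\<gamma> = 0\<close> and \<open>\<psi>(\<xi>)\<eta>(V) = 0\<close>, so that the
  formula reduces to \<open>2\<lambda> = \<beta>(r + 2n) + p + 2/(2n+1) - 2\<mu>\<close>. (Evaluating the soliton equation at
  \<open>(\<xi>, \<xi>)\<close> gives \<open>\<lambda>\<close> with \<open>- \<gamma>\<close> instead of \<open>\<gamma>\<close>; the two agree because \<open>\<gamma> = 0\<close>.)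

  The torsion cancels in the Lie derivative, so the first term of the soliton equation is the
  ordinary \<open>\<L>\<^sub>V g = 2\<mu> g + \<psi> \<odot> g(V, \<cdot>)\<close>. As \<open>\<eta>\<close> is dual to the Killing field \<open>\<xi>\<close>, its covariant
  derivative is \<open>g(X, \<phi>Y)\<close>, hence the Ricci tensor of the SSNM connection is
  \<open>S(Y,Z) - 2n g(Y, \<phi>Z) + 2n \<eta>(Y)\<eta>(Z)\<close> and its scalar curvature is \<open>r + 2n\<close>. The skew part of the
  soliton equation is a multiple of \<open>\<alpha> g(Y, \<phi>Z)\<close>, so \<open>\<alpha> = 0\<close>. What remains is
  \<open>\<psi> \<odot> g(V, \<cdot>) + q g + 2\<gamma> \<eta> \<otimes> \<eta> = 0\<close>. On the plane of \<open>e\<close> and \<open>\<phi>e\<close> with \<open>e \<bottom> \<xi>\<close> a symmetric product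
  of two covectors is not definite, so \<open>q = 0\<close>; and \<open>\<gamma> \<noteq> 0\<close> would make \<open>V\<close> proportional to \<open>\<xi>\<close>,
  which contradicts that the contact distribution is nowhere integrable.

  The curvature operators are skew-adjoint at the level of vector fields, which makes them
  tensorial in their last argument without any locality argument; what is needed of the manifold
  is that every tangent space has the right dimension and consists of values of global vector
  fields, i.e. bump functions and Hadamard's lemma.
\<close>

section \<open>Calculus of smooth maps\<close>

lemma frechet_derivative_cong_open:
  assumes "open S" "x \<in> S" "\<And>y. y \<in> S \<Longrightarrow> f y = g y"
  shows "frechet_derivative f (at x) = frechet_derivative g (at x)"
proof -
  \<comment> \<open>Both functions have the same derivatives at \<open>x\<close>, so the choice
    operator inside \<open>frechet_derivative\<close> picks the same map even where neither is
    differentiable.\<close>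
  have "(f has_derivative f') (at x) \<longleftrightarrow> (g has_derivative f') (at x)" for f'
    using assms has_derivative_transform_within_open[OF _ assms(1,2)] by metis
  then show ?thesis
    by (simp add: frechet_derivative_def)
qed

lemma Ck_on_cong:
  assumes "open S" "\<And>y. y \<in> S \<Longrightarrow> f y = g y"
  shows "Ck_on k S f \<longleftrightarrow> Ck_on k S g"
  using assms(2)
proof (induction k arbitrary: f g)
  case 0
  then show ?case by (auto intro: continuous_on_cong)
next
  case (Suc k)
  have "f differentiable (at x) \<longleftrightarrow> g differentiable (at x)" if "x \<in> S" for x
    unfolding differentiable_def
    using Suc.prems has_derivative_transform_within_open[OF _ assms(1) that] by metis
  moreover have "Ck_on k S (\<lambda>x. frechet_derivative f (at x) v) \<longleftrightarrow>
      Ck_on k S (\<lambda>x. frechet_derivative g (at x) v)" for v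
    by (rule Suc.IH) (use frechet_derivative_cong_open[OF assms(1)] Suc.prems in metis)
  ultimately show ?case by simp
qed

text \<open>Any explicit formula \<open>f'\<close> for the derivative may replace the one chosen by
  \<open>frechet_derivative\<close>; the differentiation rules enter the inductions below through
  it.\<close>

lemma Ck_on_SucI:
  assumes "open S" "\<And>x. x \<in> S \<Longrightarrow> (f has_derivative f' x) (at x)"
    "\<And>v. Ck_on k S (\<lambda>x. f' x v)"
  shows "Ck_on (Suc k) S f"
proof -
  have "Ck_on k S (\<lambda>x. frechet_derivative f (at x) v)" for v
    by (subst Ck_on_cong[OF assms(1), where g = "\<lambda>x. f' x v"])
      (use frechet_derivative_at[OF assms(2)] assms(3) in auto)
  then show ?thesis
    using assms(2) by (auto simp: differentiable_def)
qed

lemma Ck_on_SucD: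
  assumes "Ck_on (Suc k) S f"
  shows "x \<in> S \<Longrightarrow> (f has_derivative frechet_derivative f (at x)) (at x)"
    and "Ck_on k S (\<lambda>x. frechet_derivative f (at x) v)"
  using assms by (auto simp: frechet_derivative_works)

lemma Ck_on_Suc_imp: "Ck_on (Suc k) S f \<Longrightarrow> Ck_on k S f"
proof (induction k arbitrary: f)
  case 0
  then show ?case
    by (auto intro!: differentiable_imp_continuous_on differentiable_at_imp_differentiable_on)
qed auto

lemma Ck_on_continuous: "Ck_on k S f \<Longrightarrow> continuous_on S f"
proof (induction k)
  case (Suc k)
  then show ?case using Ck_on_Suc_imp by blast
qed auto

lemma Ck_on_subset: "Ck_on k S f \<Longrightarrow> T \<subseteq> S \<Longrightarrow> Ck_on k T f"
  by (induction k arbitrary: f) (auto intro: continuous_on_subset)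

lemma Ck_on_local:
  assumes "\<And>x. x \<in> S \<Longrightarrow> \<exists>T. open T \<and> x \<in> T \<and> Ck_on k T f"
  shows "Ck_on k S f"
  using assms
proof (induction k arbitrary: f)
  case 0
  then show ?case
    by (metis Ck_on.simps(1) continuous_at_imp_continuous_on continuous_on_eq_continuous_at)
next
  case (Suc k)
  have "f differentiable (at x)" if "x \<in> S" for x
    using Suc.prems[OF that] by auto
  moreover have "Ck_on k S (\<lambda>x. frechet_derivative f (at x) v)" for v
    by (rule Suc.IH) (use Suc.prems in force)
  ultimately show ?case by auto
qed

lemma Ck_on_const: "open S \<Longrightarrow> Ck_on k S (\<lambda>_. c)"
proof (induction k arbitrary: c)
  case (Suc k)
  show ?case
    by (rule Ck_on_SucI[where f' = "\<lambda>_ _. 0"]) (use Suc in auto)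
qed auto

lemma Ck_on_add:
  "open S \<Longrightarrow> Ck_on k S f \<Longrightarrow> Ck_on k S g \<Longrightarrow> Ck_on k S (\<lambda>x. f x + g x)"
proof (induction k arbitrary: f g)
  case 0
  then show ?case by (auto intro: continuous_intros)
next
  case (Suc k)
  show ?case
    by (rule Ck_on_SucI[OF Suc.prems(1) has_derivative_add[OF Ck_on_SucD(1)[OF Suc.prems(2)]
        Ck_on_SucD(1)[OF Suc.prems(3)]] Suc.IH])
      (use Suc.prems in auto)
qed

lemma Ck_on_linear:
  assumes "bounded_linear L"
  shows "open S \<Longrightarrow> Ck_on k S f \<Longrightarrow> Ck_on k S (\<lambda>x. L (f x))"
proof (induction k arbitrary: f)
  case 0
  then show ?case by (auto intro: bounded_linear.continuous_on[OF assms])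
next
  case (Suc k)
  show ?case
    by (rule Ck_on_SucI[OF Suc.prems(1) bounded_linear.has_derivative[OF assms
        Ck_on_SucD(1)[OF Suc.prems(2)]] Suc.IH])
      (use Suc.prems in auto)
qed

lemma Ck_on_ident: "open S \<Longrightarrow> Ck_on k S (\<lambda>x. x)"
proof (cases k)
  case (Suc k')
  assume "open S"
  then show ?thesis unfolding Suc
    by (intro Ck_on_SucI[where f' = "\<lambda>_ v. v"]) (auto intro: Ck_on_const)
qed auto

lemma Ck_on_mult:
  fixes f g :: "'e::euclidean_space \<Rightarrow> real"
  shows "open S \<Longrightarrow> Ck_on k S f \<Longrightarrow> Ck_on k S g \<Longrightarrow> Ck_on k S (\<lambda>x. f x * g x)"
proof (induction k arbitrary: f g)
  case 0
  then show ?case by (auto intro: continuous_intros)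
next
  case (Suc k)
  show ?case
  proof (rule Ck_on_SucI[OF Suc.prems(1) has_derivative_mult[OF Ck_on_SucD(1)[OF Suc.prems(2)]
        Ck_on_SucD(1)[OF Suc.prems(3)]]])
    show "Ck_on k S (\<lambda>x. f x * frechet_derivative g (at x) v + frechet_derivative f (at x) v * g x)" for v
      by (intro Ck_on_add Suc.IH Suc.prems(1) Ck_on_SucD[OF Suc.prems(2)]
          Ck_on_SucD[OF Suc.prems(3)] Ck_on_Suc_imp[OF Suc.prems(2)] Ck_on_Suc_imp[OF Suc.prems(3)])
  qed
qed

lemma Ck_on_sum:
  assumes "open S" "\<And>i. i \<in> I \<Longrightarrow> Ck_on k S (f i)"
  shows "Ck_on k S (\<lambda>x. \<Sum>i\<in>I. f i x)"
  using assms(2)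
  by (induction I rule: infinite_finite_induct) (auto intro: Ck_on_const Ck_on_add assms(1))

text \<open>The chain rule gives Df(g x)(Dg(x) v), where base point and direction both vary with
  \<open>x\<close>. Expanding the direction in \<open>Basis\<close> turns it into a finite sum of
  products of real functions, to which the product rule and the induction hypothesis apply.\<close>

lemma Ck_on_compose:
  fixes f :: "'b::euclidean_space \<Rightarrow> real" and g :: "'e::euclidean_space \<Rightarrow> 'b"
  shows "open S \<Longrightarrow> g ` S \<subseteq> T \<Longrightarrow> Ck_on k T f \<Longrightarrow> Ck_on k S g \<Longrightarrow> Ck_on k S (\<lambda>x. f (g x))"
proof (induction k arbitrary: f)
  case 0
  then show ?case by (auto intro: continuous_on_compose2)
next
  case (Suc k)
  let ?Df = "\<lambda>y. frechet_derivative f (at y)" and ?Dg = "\<lambda>x. frechet_derivative g (at x)"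
  have expand: "?Df y w = (\<Sum>i\<in>Basis. (w \<bullet> i) * ?Df y i)" if "y \<in> T" for y w
  proof -
    interpret bounded_linear "?Df y"
      using Ck_on_SucD(1)[OF Suc.prems(3) that] by (rule has_derivative_bounded_linear)
    have "?Df y w = ?Df y (\<Sum>i\<in>Basis. (w \<bullet> i) *\<^sub>R i)"
      by (simp add: euclidean_representation)
    then show ?thesis by (simp add: sum scaleR)
  qed
  show ?case
  proof (rule Ck_on_SucI[OF Suc.prems(1)])
    show "((\<lambda>x. f (g x)) has_derivative (\<lambda>v. \<Sum>i\<in>Basis. (?Dg x v \<bullet> i) * ?Df (g x) i)) (at x)"
      if "x \<in> S" for x
    proof -
      have "g x \<in> T" using Suc.prems that by auto
      then show ?thesis
        using has_derivative_compose[OF Ck_on_SucD(1)[OF Suc.prems(4) that]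
            Ck_on_SucD(1)[OF Suc.prems(3)]]
        by (simp add: expand)
    qed
    show "Ck_on k S (\<lambda>x. \<Sum>i\<in>Basis. (?Dg x v \<bullet> i) * ?Df (g x) i)" for v
      by (intro Ck_on_sum Ck_on_mult Suc.IH Suc.prems(1,2) Ck_on_SucD(2)[OF Suc.prems(3)]
          Ck_on_Suc_imp[OF Suc.prems(4)]
          Ck_on_linear[OF bounded_linear_inner_left] Ck_on_SucD(2)[OF Suc.prems(4)])
  qed
qed

lemma smooth_on_cong:
  assumes "open S" "\<And>y. y \<in> S \<Longrightarrow> f y = g y"
  shows "smooth_on S f \<longleftrightarrow> smooth_on S g"
  using Ck_on_cong[OF assms] by (simp add: smooth_on_def)

lemma smooth_on_subset: "smooth_on S f \<Longrightarrow> T \<subseteq> S \<Longrightarrow> smooth_on T f"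
  by (auto simp: smooth_on_def intro: Ck_on_subset)

lemma smooth_on_local:
  assumes "\<And>x. x \<in> S \<Longrightarrow> \<exists>T. open T \<and> x \<in> T \<and> smooth_on T f"
  shows "smooth_on S f"
  using assms Ck_on_local unfolding smooth_on_def by meson

lemma smooth_on_const: "open S \<Longrightarrow> smooth_on S (\<lambda>_. c)"
  by (simp add: smooth_on_def Ck_on_const)

lemma smooth_on_ident: "open S \<Longrightarrow> smooth_on S (\<lambda>x. x)"
  by (simp add: smooth_on_def Ck_on_ident)

lemma smooth_on_linear:
  "bounded_linear L \<Longrightarrow> open S \<Longrightarrow> smooth_on S f \<Longrightarrow> smooth_on S (\<lambda>x. L (f x))"
  by (simp add: smooth_on_def Ck_on_linear)

lemma smooth_on_add:
  "open S \<Longrightarrow> smooth_on S f \<Longrightarrow> smooth_on S g \<Longrightarrow> smooth_on S (\<lambda>x. f x + g x)"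
  by (simp add: smooth_on_def Ck_on_add)

lemma smooth_on_mult:
  fixes f g :: "'e::euclidean_space \<Rightarrow> real"
  shows "open S \<Longrightarrow> smooth_on S f \<Longrightarrow> smooth_on S g \<Longrightarrow> smooth_on S (\<lambda>x. f x * g x)"
  by (simp add: smooth_on_def Ck_on_mult)

lemma smooth_on_sum:
  "open S \<Longrightarrow> (\<And>i. i \<in> I \<Longrightarrow> smooth_on S (f i)) \<Longrightarrow> smooth_on S (\<lambda>x. \<Sum>i\<in>I. f i x)"
  by (simp add: smooth_on_def Ck_on_sum)

lemma smooth_on_compose:
  fixes f :: "'b::euclidean_space \<Rightarrow> real" and g :: "'e::euclidean_space \<Rightarrow> 'b"
  shows "open S \<Longrightarrow> g ` S \<subseteq> T \<Longrightarrow> smooth_on T f \<Longrightarrow> smooth_on S g \<Longrightarrow> smooth_on S (\<lambda>x. f (g x))"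
  by (simp add: smooth_on_def Ck_on_compose)

lemma smooth_on_has_derivative:
  "smooth_on S f \<Longrightarrow> x \<in> S \<Longrightarrow> (f has_derivative frechet_derivative f (at x)) (at x)"
  using Ck_on_SucD(1) unfolding smooth_on_def by blast

lemma smooth_on_frechet_derivative:
  "smooth_on S f \<Longrightarrow> smooth_on S (\<lambda>x. frechet_derivative f (at x) v)"
  using Ck_on_SucD(2) unfolding smooth_on_def by blast

section \<open>Flat functions and bump functions\<close>

definition flat :: "nat \<Rightarrow> real \<Rightarrow> real"
  where "flat m t = (if t > 0 then exp (- 1 / t) / t ^ m else 0)"

text \<open>The family exp(-1/t) / t^m is closed under differentiation up to linear combinations,
  which is why the exponent is a parameter. The delicate point is 0, where exponential decay beats
  every power.\<close>

lemma flat_has_derivative: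
  "(flat m has_real_derivative flat (m + 2) t - real m * flat (m + 1) t) (at t)"
proof -
  consider "t > 0" | "t < 0" | "t = 0" by linarith
  then show ?thesis
  proof cases
    case 1
    \<comment> \<open>For \<open>m = 0\<close> the exponent \<open>m - 1\<close> is truncated, but
      both sides vanish through the factor \<open>real m\<close>.\<close>
    have power: "real m * t ^ (m - 1) = real m * t ^ m / t"
      using 1 by (cases m) auto
    have "((\<lambda>t. exp (- 1 / t) / t ^ m) has_real_derivative
        (exp (- 1 / t) * (1 / (t * t)) * t ^ m - exp (- 1 / t) * (real m * t ^ (m - 1))) / (t ^ m * t ^ m)) (at t)"
      using 1 by (auto intro!: derivative_eq_intros)
    also have "(exp (- 1 / t) * (1 / (t * t)) * t ^ m - exp (- 1 / t) * (real m * t ^ (m - 1))) / (t ^ m * t ^ m) =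
        flat (m + 2) t - real m * flat (m + 1) t"
      unfolding power using 1 by (simp add: flat_def divide_simps power_add power2_eq_square) (simp add: algebra_simps)
    finally have "((\<lambda>t. exp (- 1 / t) / t ^ m) has_real_derivative
        flat (m + 2) t - real m * flat (m + 1) t) (at t)" .
    then show ?thesis
      by (rule has_field_derivative_transform_within_open[where S = "{0<..}"])
        (use 1 in \<open>auto simp: flat_def\<close>)
  next
    case 2
    have "((\<lambda>_. 0) has_real_derivative flat (m + 2) t - real m * flat (m + 1) t) (at t)"
      using 2 by (simp add: flat_def)
    then show ?thesis
      by (rule has_field_derivative_transform_within_open[where S = "{..<0}"])
        (use 2 in \<open>auto simp: flat_def\<close>)
  next
    case 3
    \<comment> \<open>With s = 1/h the difference quotient of \<open>flat m\<close> at 0 from the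
      right becomes s^(m+1) / exp s.\<close>
    have "((\<lambda>s::real. s ^ Suc m / exp s) \<longlongrightarrow> 0) at_top"
      by (rule tendsto_power_div_exp_0)
    from filterlim_compose[OF this filterlim_inverse_at_top_right]
    have "((\<lambda>h::real. inverse h ^ Suc m / exp (inverse h)) \<longlongrightarrow> 0) (at_right 0)" .
    then have right: "((\<lambda>h::real. flat m h / h) \<longlongrightarrow> 0) (at_right 0)"
      by (rule Lim_transform_eventually)
        (auto simp: eventually_at_filter flat_def field_simps exp_minus power_inverse)
    have left: "((\<lambda>h::real. flat m h / h) \<longlongrightarrow> 0) (at_left 0)"
      by (rule tendsto_eventually) (auto simp: eventually_at_filter flat_def)
    have "((\<lambda>h::real. flat m h / h) \<longlongrightarrow> 0) (at 0)"
      using left right by (simp add: filterlim_split_at)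
    then show ?thesis
      by (simp add: 3 DERIV_def flat_def)
  qed
qed

lemma Ck_on_flat: "Ck_on k UNIV (flat m)"
proof (induction k arbitrary: m)
  case 0
  have "continuous_on UNIV (flat m)"
    using flat_has_derivative by (intro DERIV_continuous_on) auto
  then show ?case by simp
next
  case (Suc k)
  show ?case
  proof (rule Ck_on_SucI)
    show "(flat m has_derivative (\<lambda>v. (flat (m + 2) t + (- real m) * flat (m + 1) t) * v)) (at t)" for t
      using flat_has_derivative[of m t] by (simp add: has_field_derivative_def)
    show "Ck_on k UNIV (\<lambda>t. (flat (m + 2) t + (- real m) * flat (m + 1) t) * v)" for v
      by (intro Ck_on_mult Ck_on_add Ck_on_const Suc.IH open_UNIV)
  qed auto
qed

text \<open>The bump is the flat function of \<epsilon>^2 - |z - z0|^2, divided by its value at the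
  centre; it vanishes off the closed ball of radius \<epsilon>, which serves as
  \<open>K\<close>.\<close>

lemma exists_bump:
  fixes z0 :: "'e::euclidean_space"
  assumes "open S" "z0 \<in> S"
  obtains b K where "smooth_on UNIV b" "b z0 = (1::real)" "compact K" "K \<subseteq> S" "\<And>z. z \<notin> K \<Longrightarrow> b z = 0"
proof -
  obtain \<epsilon> where \<epsilon>: "\<epsilon> > 0" "cball z0 \<epsilon> \<subseteq> S"
    using assms open_contains_cball by blast
  define q where "q z = \<epsilon>\<^sup>2 + (- 1) * (\<Sum>i\<in>Basis. ((z - z0) \<bullet> i) * ((z - z0) \<bullet> i))" for z :: 'e
  have q: "q z = \<epsilon>\<^sup>2 - (norm (z - z0))\<^sup>2" for z
    by (simp add: q_def power2_norm_eq_inner euclidean_inner[of "z - z0" "z - z0"])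
  define b where "b z = inverse (flat 0 (\<epsilon>\<^sup>2)) * flat 0 (q z)" for z
  have lin: "smooth_on UNIV (\<lambda>z. (z - z0) \<bullet> i)" for i :: 'e
    using smooth_on_add[OF open_UNIV smooth_on_ident smooth_on_const, of "- z0"]
    by (intro smooth_on_linear[OF bounded_linear_inner_left]) auto
  have "smooth_on UNIV q"
    unfolding q_def
    by (intro smooth_on_add smooth_on_mult smooth_on_sum smooth_on_const lin open_UNIV)
  moreover have "smooth_on UNIV (flat 0)"
    using Ck_on_flat by (auto simp: smooth_on_def)
  ultimately have "smooth_on UNIV b"
    unfolding b_def
    by (intro smooth_on_mult smooth_on_const open_UNIV smooth_on_compose[where g = q and f = "flat 0" and T = UNIV])
      auto
  moreover have "b z0 = 1"
    using \<epsilon> by (simp add: b_def q flat_def)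
  moreover have "b z = 0" if "z \<notin> cball z0 \<epsilon>" for z
  proof -
    have "\<epsilon>\<^sup>2 \<le> (norm (z - z0))\<^sup>2"
      using that \<epsilon> by (intro power_mono) (auto simp: dist_norm norm_minus_commute)
    then show ?thesis by (simp add: b_def q flat_def)
  qed
  ultimately show ?thesis
    using that \<epsilon> compact_cball by blast
qed

text \<open>\<open>S\<close> and the complement of \<open>K\<close> form an open cover of the space;
  the extension is \<open>f\<close> on the first set and 0 on the second.\<close>

lemma smooth_on_extend_zero:
  fixes f :: "'e::euclidean_space \<Rightarrow> real"
  assumes "open S" "smooth_on S f" "closed K" "K \<subseteq> S" "\<And>z. z \<in> S - K \<Longrightarrow> f z = 0"
  shows "smooth_on UNIV (\<lambda>z. if z \<in> S then f z else 0)"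
proof (rule smooth_on_local)
  fix x
  show "\<exists>T. open T \<and> x \<in> T \<and> smooth_on T (\<lambda>z. if z \<in> S then f z else 0)"
  proof (cases "x \<in> S")
    case True
    then show ?thesis
      using assms smooth_on_cong[OF assms(1), of "\<lambda>z. if z \<in> S then f z else 0" f] by auto
  next
    case False
    have "smooth_on (- K) (\<lambda>z. if z \<in> S then f z else 0)"
      using assms smooth_on_const[of "- K" "0::real"]
      by (subst smooth_on_cong[where g = "\<lambda>_. 0"]) auto
    then show ?thesis
      using False assms by (intro exI[of _ "- K"]) auto
  qed
qed

section \<open>Integrals along segments and Hadamard's lemma\<close>

lemma Ck_on_segment_integral:
  fixes F :: "'e::euclidean_space \<Rightarrow> real"
  shows "Ck_on k UNIV F \<Longrightarrow>
    Ck_on k UNIV (\<lambda>z. integral {0..1} (\<lambda>t. t ^ m * F (z0 + t *\<^sub>R (z - z0))))"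
\<comment> \<open>Differentiating under the integral pulls a factor \<open>t\<close> out of the
  inner map and so raises the power; hence the induction runs over all weights t^m and all
  integrands.\<close>
proof (induction k arbitrary: F m)
  case 0
  then have F: "continuous_on UNIV F" by simp
  have "continuous_on UNIV (\<lambda>z. integral (cbox 0 (1::real)) (\<lambda>t. t ^ m * F (z0 + t *\<^sub>R (z - z0))))"
    by (rule integral_continuous_on_param)
      (auto simp: case_prod_unfold intro!: continuous_intros continuous_on_compose2[OF F])
  then show ?case by simp
next
  case (Suc k)
  \<comment> \<open>The derivative is packaged as a bounded linear map because
    \<open>leibniz_rule\<close> asks for a derivative in this form, continuous jointly in
    \<open>z\<close> and \<open>t\<close>.\<close>
  define F' where "F' y = Blinfun (frechet_derivative F (at y))" for y
  have F'_apply: "blinfun_apply (F' y) = frechet_derivative F (at y)" for y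
    unfolding F'_def
    by (rule bounded_linear_Blinfun_apply, rule has_derivative_bounded_linear)
      (use Ck_on_SucD(1)[OF Suc.prems] in auto)
  have contF': "continuous_on UNIV F'"
    by (rule continuous_on_blinfun_componentwise)
      (auto simp: F'_apply intro!: Ck_on_continuous Ck_on_SucD[OF Suc.prems])
  have contF: "continuous_on UNIV F"
    using Suc.prems by (rule Ck_on_continuous)
  define fx where "fx z t = t ^ Suc m *\<^sub>R F' (z0 + t *\<^sub>R (z - z0))" for z and t :: real
  have cont_fx: "continuous_on (UNIV \<times> cbox 0 1) (\<lambda>(z, t). fx z t)"
    unfolding fx_def case_prod_unfold
    by (intro continuous_intros continuous_on_compose2[OF contF']) auto
  have "((\<lambda>z. integral (cbox 0 1) (\<lambda>t. t ^ m * F (z0 + t *\<^sub>R (z - z0)))) has_derivative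
      blinfun_apply (integral (cbox 0 1) (fx z))) (at z within UNIV)" for z
  proof (rule leibniz_rule[OF _ _ cont_fx])
    fix z and t :: real
    have "((\<lambda>z. z0 + t *\<^sub>R (z - z0)) has_derivative (\<lambda>v. t *\<^sub>R v)) (at z)"
      by (auto intro!: derivative_eq_intros)
    from has_derivative_compose[OF this Ck_on_SucD(1)[OF Suc.prems]]
    have "((\<lambda>z. F (z0 + t *\<^sub>R (z - z0))) has_derivative (\<lambda>v. F' (z0 + t *\<^sub>R (z - z0)) (t *\<^sub>R v))) (at z)"
      by (simp add: F'_apply)
    then have "((\<lambda>z. t ^ m * F (z0 + t *\<^sub>R (z - z0))) has_derivative
        (\<lambda>v. t ^ m * F' (z0 + t *\<^sub>R (z - z0)) (t *\<^sub>R v))) (at z)"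
      by (rule has_derivative_mult_right)
    moreover have "(\<lambda>v. t ^ m * F' (z0 + t *\<^sub>R (z - z0)) (t *\<^sub>R v)) = blinfun_apply (fx z t)"
      by (auto simp: fx_def blinfun.scaleR_left blinfun.scaleR_right)
    ultimately show "((\<lambda>z. t ^ m * F (z0 + t *\<^sub>R (z - z0))) has_derivative fx z t) (at z within UNIV)"
      by simp
    show "(\<lambda>t. t ^ m * F (z0 + t *\<^sub>R (z - z0))) integrable_on cbox 0 1"
      by (rule integrable_continuous)
        (auto intro!: continuous_intros continuous_on_compose2[OF contF])
  qed auto
  moreover have "integral (cbox 0 1) (fx z) v =
      integral {0..1} (\<lambda>t. t ^ Suc m * frechet_derivative F (at (z0 + t *\<^sub>R (z - z0))) v)" for z v
  proof -
    have "fx z integrable_on cbox 0 1"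
      unfolding fx_def
      by (rule integrable_continuous) (auto intro!: continuous_intros continuous_on_compose2[OF contF'])
    from integral_linear[OF this, of "\<lambda>b. blinfun_apply b v"]
    show ?thesis
      by (simp add: o_def fx_def blinfun.scaleR_left F'_apply blinfun.bounded_linear_left)
  qed
  ultimately have "((\<lambda>z. integral {0..1} (\<lambda>t. t ^ m * F (z0 + t *\<^sub>R (z - z0)))) has_derivative
      (\<lambda>v. integral {0..1} (\<lambda>t. t ^ Suc m * frechet_derivative F (at (z0 + t *\<^sub>R (z - z0))) v))) (at z)" for z
    by (metis (no_types, lifting) ext cbox_interval)
  then show ?case
    by (rule Ck_on_SucI[OF open_UNIV]) (rule Suc.IH, rule Ck_on_SucD[OF Suc.prems])
qed

text \<open>The fundamental theorem of calculus along the segment from \<open>z0\<close> to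
  \<open>z\<close>: \<open>G i z\<close> is the mean over that segment of the derivative of
  \<open>F\<close> in direction \<open>i\<close>.\<close>

lemma Hadamard_lemma:
  fixes F :: "'e::euclidean_space \<Rightarrow> real"
  assumes F: "smooth_on UNIV F"
  obtains G where "\<And>i. smooth_on UNIV (G i)" "\<And>i. G i z0 = frechet_derivative F (at z0) i"
    "\<And>z. F z = F z0 + (\<Sum>i\<in>Basis. ((z - z0) \<bullet> i) * G i z)"
proof -
  let ?F' = "\<lambda>y. frechet_derivative F (at y)"
  \<comment> \<open>The factor \<open>t ^ 0\<close> gives the integrand the shape of the weighted
    segment integrals above.\<close>
  define G where "G i z = integral {0..1} (\<lambda>t. t ^ 0 * ?F' (z0 + t *\<^sub>R (z - z0)) i)" for i z
  have smF': "smooth_on UNIV (\<lambda>y. ?F' y i)" for i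
    using F by (rule smooth_on_frechet_derivative)
  then have contF': "continuous_on UNIV (\<lambda>y. ?F' y i)" for i
    by (metis Ck_on_continuous smooth_on_def)
  have 1: "smooth_on UNIV (G i)" for i
    using smF' Ck_on_segment_integral[of _ "\<lambda>y. ?F' y i" 0 z0 for i]
    by (simp add: smooth_on_def G_def[abs_def])
  have 2: "G i z0 = ?F' z0 i" for i
    by (simp add: G_def)
  have 3: "F z = F z0 + (\<Sum>i\<in>Basis. ((z - z0) \<bullet> i) * G i z)" for z
  proof -
    let ?p = "\<lambda>t::real. z0 + t *\<^sub>R (z - z0)"
    have "((\<lambda>t. F (?p t)) has_vector_derivative ?F' (?p t) (z - z0)) (at t within {0..1})" for t
    proof -
      interpret bounded_linear "?F' (?p t)"
        using smooth_on_has_derivative[OF F UNIV_I] by (rule has_derivative_bounded_linear)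
      have "(?p has_derivative (\<lambda>h. h *\<^sub>R (z - z0))) (at t within {0..1})"
        by (auto intro!: derivative_eq_intros)
      from has_derivative_compose[OF this smooth_on_has_derivative[OF F UNIV_I]]
      show ?thesis by (simp add: has_vector_derivative_def scaleR)
    qed
    then have "((\<lambda>t. ?F' (?p t) (z - z0)) has_integral F (?p 1) - F (?p 0)) {0..1}"
      by (intro fundamental_theorem_of_calculus) auto
    moreover have "?F' (?p t) (z - z0) = (\<Sum>i\<in>Basis. ((z - z0) \<bullet> i) * ?F' (?p t) i)" for t
    proof -
      interpret bounded_linear "?F' (?p t)"
        using smooth_on_has_derivative[OF F UNIV_I] by (rule has_derivative_bounded_linear)
      have "?F' (?p t) (z - z0) = ?F' (?p t) (\<Sum>i\<in>Basis. ((z - z0) \<bullet> i) *\<^sub>R i)"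
        by (simp only: euclidean_representation)
      then show ?thesis by (simp add: sum scaleR)
    qed
    ultimately have "((\<lambda>t. \<Sum>i\<in>Basis. ((z - z0) \<bullet> i) * ?F' (?p t) i) has_integral F z - F z0) {0..1}"
      by simp
    moreover have "((\<lambda>t. \<Sum>i\<in>Basis. ((z - z0) \<bullet> i) * ?F' (?p t) i) has_integral
        (\<Sum>i\<in>Basis. ((z - z0) \<bullet> i) * G i z)) {0..1}"
    proof (intro has_integral_sum has_integral_mult_right)
      fix i :: 'e
      have "(\<lambda>t. ?F' (?p t) i) integrable_on {0..1}"
        by (intro integrable_continuous_interval continuous_on_compose2[OF contF'] continuous_intros) auto
      then show "((\<lambda>t. ?F' (?p t) i) has_integral G i z) {0..1}"
        by (simp add: G_def integrable_integral)
    qed auto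
    ultimately have "F z - F z0 = (\<Sum>i\<in>Basis. ((z - z0) \<bullet> i) * G i z)"
      by (rule has_integral_unique)
    then show ?thesis by simp
  qed
  show ?thesis using that[OF 1 2 3] .
qed

section \<open>Tangent spaces\<close>

lemma sum_fun_apply: "(\<Sum>i\<in>I. f i) x = (\<Sum>i\<in>I. f i x)"
  by (induction I rule: infinite_finite_induct) auto

section \<open>Charts and smooth functions\<close>

locale smooth_mfd =
  fixes A :: "('a::{t2_space,second_countable_topology}, 'e::euclidean_space) chart set"
    and m :: nat
  assumes smooth_manifold: "smooth_manifold A m"
begin

lemma dim_model: "DIM('e) = m"
  using smooth_manifold by (simp add: smooth_manifold_def)

lemma chart_homeomorphism:
  assumes "(U, c) \<in> A"
  shows "open U" "open (c ` U)" "homeomorphism U (c ` U) c (inv_into U c)"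
  using smooth_manifold assms by (auto simp: smooth_manifold_def is_chart_def split: prod.splits)

lemma chart_inverse [simp]:
  assumes "(U, c) \<in> A"
  shows "y \<in> U \<Longrightarrow> inv_into U c (c y) = y" "z \<in> c ` U \<Longrightarrow> inv_into U c z \<in> U"
  using homeomorphism_apply1[OF chart_homeomorphism(3)[OF assms]] by auto

lemma chart_open_image:
  assumes "(U, c) \<in> A" "open T" "T \<subseteq> U"
  shows "open (c ` T)"
proof -
  have "openin (top_of_set (c ` U)) (c ` T)"
    using homeomorphism_imp_open_map[OF chart_homeomorphism(3)[OF assms(1)]] assms
    by (simp add: open_subset)
  then show ?thesis
    using chart_homeomorphism(2)[OF assms(1)] openin_open_trans by blast
qed

lemma chart_at: obtains U c where "(U, c) \<in> A" "x \<in> U"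
proof -
  have "x \<in> (\<Union>C\<in>A. fst C)"
    using smooth_manifold by (simp add: smooth_manifold_def)
  then show ?thesis using that by auto
qed

lemma smooth_transition:
  "(U, c) \<in> A \<Longrightarrow> (W, d) \<in> A \<Longrightarrow> smooth_on (c ` (U \<inter> W)) (d \<circ> inv_into U c)"
  using smooth_manifold by (auto simp: smooth_manifold_def split: prod.splits)

lemma smooth_fun_chart:
  "smooth_fun A f \<Longrightarrow> (U, c) \<in> A \<Longrightarrow> smooth_on (c ` U) (\<lambda>z. f (inv_into U c z))"
  by (auto simp: smooth_fun_def o_def)

lemma smooth_funI:
  "(\<And>U c. (U, c) \<in> A \<Longrightarrow> smooth_on (c ` U) (\<lambda>z. f (inv_into U c z))) \<Longrightarrow> smooth_fun A f"
  by (auto simp: smooth_fun_def o_def)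

lemma smooth_fun_const: "smooth_fun A (\<lambda>_. k)"
  by (auto intro!: smooth_funI smooth_on_const chart_homeomorphism)

lemma smooth_fun_add: "smooth_fun A f \<Longrightarrow> smooth_fun A h \<Longrightarrow> smooth_fun A (\<lambda>y. f y + h y)"
  by (auto intro!: smooth_funI smooth_on_add intro: chart_homeomorphism smooth_fun_chart)

lemma smooth_fun_mult: "smooth_fun A f \<Longrightarrow> smooth_fun A h \<Longrightarrow> smooth_fun A (\<lambda>y. f y * h y)"
  by (auto intro!: smooth_funI smooth_on_mult intro: chart_homeomorphism smooth_fun_chart)

lemma smooth_fun_minus: "smooth_fun A f \<Longrightarrow> smooth_fun A (\<lambda>y. - f y)"
  using smooth_fun_mult[OF smooth_fun_const[of "- 1"]] by simp

lemma smooth_fun_diff: "smooth_fun A f \<Longrightarrow> smooth_fun A h \<Longrightarrow> smooth_fun A (\<lambda>y. f y - h y)"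
  using smooth_fun_add[OF _ smooth_fun_minus] by simp

lemma smooth_fun_sum:
  "(\<And>i. i \<in> I \<Longrightarrow> smooth_fun A (f i)) \<Longrightarrow> smooth_fun A (\<lambda>y. \<Sum>i\<in>I. f i y)"
  by (induction I rule: infinite_finite_induct) (auto intro: smooth_fun_const smooth_fun_add)

text \<open>Seen in a second chart, the function is smooth near points of \<open>U\<close> by the
  transition map, and it vanishes near all other points, since they avoid the preimage of
  \<open>K\<close>. That preimage is compact, hence closed because the manifold is
  Hausdorff.\<close>

lemma smooth_fun_extend_zero:
  assumes chart: "(U, c) \<in> A" and F: "smooth_on (c ` U) F"
    and K: "compact K" "K \<subseteq> c ` U" "\<And>z. z \<notin> K \<Longrightarrow> F z = 0"
  shows "smooth_fun A (\<lambda>y. if y \<in> U then F (c y) else 0)"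
proof (rule smooth_funI, rule smooth_on_local)
  fix W d z
  assume W: "(W, d) \<in> A" and "z \<in> d ` W"
  then obtain y where y: "y \<in> W" "z = d y" by auto
  let ?f = "\<lambda>z. if inv_into W d z \<in> U then F (c (inv_into W d z)) else 0"
  show "\<exists>T. open T \<and> z \<in> T \<and> smooth_on T ?f"
  proof (cases "y \<in> U")
    case True
    have T: "open (d ` (W \<inter> U))"
      using chart_homeomorphism(1)[OF chart] chart_homeomorphism(1)[OF W]
      by (intro chart_open_image[OF W]) auto
    have "smooth_on (d ` (W \<inter> U)) (\<lambda>z. F ((c \<circ> inv_into W d) z))"
      by (rule smooth_on_compose[OF T _ F smooth_transition[OF W chart]])
        (auto simp: chart_inverse[OF W])
    then have "smooth_on (d ` (W \<inter> U)) ?f"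
      by (subst smooth_on_cong[OF T, where g = "\<lambda>z. F ((c \<circ> inv_into W d) z)"])
        (auto simp: chart_inverse[OF W])
    then show ?thesis
      using T y True by blast
  next
    case False
    define K' where "K' = inv_into U c ` K"
    have "continuous_on K (inv_into U c)"
      using homeomorphism_cont2[OF chart_homeomorphism(3)[OF chart]] K(2) continuous_on_subset by blast
    then have "closed K'"
      unfolding K'_def by (intro compact_imp_closed compact_continuous_image K)
    then have T: "open (d ` (W - K'))"
      using chart_homeomorphism(1)[OF W] by (intro chart_open_image[OF W]) auto
    have "K' \<subseteq> U"
      using K(2) by (auto simp: K'_def chart_inverse[OF chart])
    have "F (c y') = 0" if "y' \<in> U" "y' \<notin> K'" for y'
      using that K(3) chart_inverse(1)[OF chart] by (metis K'_def image_eqI)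
    then have "smooth_on (d ` (W - K')) ?f"
      using smooth_on_const[OF T, of "0::real"]
      by (subst smooth_on_cong[OF T, where g = "\<lambda>_. 0"]) (auto simp: chart_inverse[OF W])
    then show ?thesis
      using T y False \<open>K' \<subseteq> U\<close> by blast
  qed
qed

section \<open>Tangent vectors as derivations, and coordinate fields\<close>

lemma tangent_nonsmooth: "v \<in> tangent_space A x \<Longrightarrow> \<not> smooth_fun A f \<Longrightarrow> v f = 0"
  by (auto simp: tangent_space_def)

lemma tangent_add:
  "v \<in> tangent_space A x \<Longrightarrow> smooth_fun A f \<Longrightarrow> smooth_fun A h \<Longrightarrow> v (\<lambda>y. f y + h y) = v f + v h"
  by (auto simp: tangent_space_def)

lemma tangent_mult:
  "v \<in> tangent_space A x \<Longrightarrow> smooth_fun A f \<Longrightarrow> smooth_fun A h \<Longrightarrow>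
    v (\<lambda>y. f y * h y) = f x * v h + h x * v f"
  by (auto simp: tangent_space_def)

lemma tangent_scale:
  "v \<in> tangent_space A x \<Longrightarrow> smooth_fun A f \<Longrightarrow> v (\<lambda>y. k * f y) = k * v f"
  by (auto simp: tangent_space_def)

text \<open>The product rule for 1 = 1 * 1 gives v(1) = 2 v(1); homogeneity does the rest.\<close>

lemma tangent_const:
  assumes "v \<in> tangent_space A x"
  shows "v (\<lambda>_. k) = 0"
proof -
  have "v (\<lambda>_. 1) = 0"
    using tangent_mult[OF assms smooth_fun_const smooth_fun_const, of 1 1] by simp
  then show ?thesis
    using tangent_scale[OF assms smooth_fun_const, of k 1] by simp
qed

lemma tangent_minus:
  "v \<in> tangent_space A x \<Longrightarrow> smooth_fun A f \<Longrightarrow> v (\<lambda>y. - f y) = - v f"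
  using tangent_scale[of v x f "- 1"] by simp

lemma tangent_diff:
  "v \<in> tangent_space A x \<Longrightarrow> smooth_fun A f \<Longrightarrow> smooth_fun A h \<Longrightarrow> v (\<lambda>y. f y - h y) = v f - v h"
  using tangent_add[OF _ _ smooth_fun_minus, of v x f h] tangent_minus[of v x h] by simp

lemma tangent_sum:
  "v \<in> tangent_space A x \<Longrightarrow> (\<And>i. i \<in> I \<Longrightarrow> smooth_fun A (f i)) \<Longrightarrow>
    v (\<lambda>y. \<Sum>i\<in>I. f i y) = (\<Sum>i\<in>I. v (f i))"
  by (induction I rule: infinite_finite_induct)
    (auto simp: tangent_const tangent_add[OF _ _ smooth_fun_sum])

lemma tangent_spaceI:
  assumes "\<And>f. \<not> smooth_fun A f \<Longrightarrow> v f = 0"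
    and "\<And>f h. smooth_fun A f \<Longrightarrow> smooth_fun A h \<Longrightarrow> v (\<lambda>y. f y + h y) = v f + v h"
    and "\<And>f h. smooth_fun A f \<Longrightarrow> smooth_fun A h \<Longrightarrow> v (\<lambda>y. f y * h y) = f x * v h + h x * v f"
    and "\<And>f k. smooth_fun A f \<Longrightarrow> v (\<lambda>y. k * f y) = k * v f"
  shows "v \<in> tangent_space A x"
  using assms by (auto simp: tangent_space_def)

lemma subspace_tangent_space: "subspace (tangent_space A x)"
  unfolding subspace_def
  by (auto intro!: tangent_spaceI simp: tangent_nonsmooth tangent_add tangent_mult tangent_scale algebra_simps scaleR_fun_def)

text \<open>The coordinate derivative in direction \<open>i\<close>, multiplied by a cut-off
  \<open>b\<close> and continued by 0 to become a global field. It is 0 on non-smooth arguments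
  because \<open>tangent_space\<close> demands that.\<close>

definition coord_field :: "'a set \<Rightarrow> ('a \<Rightarrow> 'e) \<Rightarrow> ('e \<Rightarrow> real) \<Rightarrow> 'e \<Rightarrow> 'a vfield" where
  "coord_field U c b i = (\<lambda>y f. if smooth_fun A f \<and> y \<in> U
     then b (c y) * frechet_derivative (\<lambda>z. f (inv_into U c z)) (at (c y)) i else 0)"

lemma coord_field_vector_field:
  assumes chart: "(U, c) \<in> A" and b: "smooth_on UNIV b" "compact K" "K \<subseteq> c ` U"
    "\<And>z. z \<notin> K \<Longrightarrow> b z = 0"
  shows "coord_field U c b i \<in> vector_fields A"
proof -
  let ?inv = "inv_into U c"
  have deriv: "((\<lambda>z. f (?inv z)) has_derivative frechet_derivative (\<lambda>z. f (?inv z)) (at (c y))) (at (c y))"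
    if "smooth_fun A f" "y \<in> U" for f y
    using smooth_fun_chart[OF that(1) chart] that(2) by (auto intro: smooth_on_has_derivative)
  have "coord_field U c b i y \<in> tangent_space A y" for y
  proof (rule tangent_spaceI)
    fix f h
    assume f: "smooth_fun A f" and h: "smooth_fun A h"
    show "coord_field U c b i y (\<lambda>y. f y + h y) = coord_field U c b i y f + coord_field U c b i y h"
      using frechet_derivative_at[OF has_derivative_add[OF deriv[OF f] deriv[OF h]], symmetric] f h
      by (auto simp: coord_field_def smooth_fun_add algebra_simps)
    show "coord_field U c b i y (\<lambda>y. f y * h y) = f y * coord_field U c b i y h + h y * coord_field U c b i y f"
      using frechet_derivative_at[OF has_derivative_mult[OF deriv[OF f] deriv[OF h]], symmetric] f h
      by (auto simp: coord_field_def smooth_fun_mult chart_inverse[OF chart] algebra_simps)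
  next
    fix f k
    assume f: "smooth_fun A f"
    show "coord_field U c b i y (\<lambda>y. k * f y) = k * coord_field U c b i y f"
      using frechet_derivative_at[OF has_derivative_mult_right[OF deriv[OF f], of _ k], symmetric] f
      by (auto simp: coord_field_def smooth_fun_mult smooth_fun_const)
  qed (simp add: coord_field_def)
  moreover have "smooth_fun A (\<lambda>y. coord_field U c b i y f)" if f: "smooth_fun A f" for f
  proof -
    have "smooth_fun A (\<lambda>y. if y \<in> U then
        b (c y) * frechet_derivative (\<lambda>z. f (?inv z)) (at (c y)) i else 0)"
      using smooth_fun_chart[OF f chart]
      by (intro smooth_fun_extend_zero[OF chart, where K = K
            and F = "\<lambda>z. b z * frechet_derivative (\<lambda>z. f (?inv z)) (at z) i"])
        (auto intro!: smooth_on_mult chart_homeomorphism[OF chart] b smooth_on_frechet_derivative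
          intro: smooth_on_subset[OF b(1)])
    then show ?thesis
      by (simp add: coord_field_def f cong: if_cong)
  qed
  ultimately show ?thesis
    by (auto simp: vector_fields_def)
qed

text \<open>The coordinate functions are cut off by the bump function \<open>b\<close> to be globally defined;
  this does not change their values under derivations at \<open>x\<close>, since \<open>b (c x) = 1\<close>.\<close>

definition coord_fun :: "'a set \<Rightarrow> ('a \<Rightarrow> 'e) \<Rightarrow> ('e \<Rightarrow> real) \<Rightarrow> 'a \<Rightarrow> 'e \<Rightarrow> 'a \<Rightarrow> real" where
  "coord_fun U c b x i = (\<lambda>y. if y \<in> U then b (c y) * ((c y - c x) \<bullet> i) else 0)"

lemma smooth_on_affine: "open S \<Longrightarrow> smooth_on S (\<lambda>z. (z - z0) \<bullet> i)"
  using smooth_on_add[OF _ smooth_on_ident smooth_on_const, of S "- z0"]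
  by (auto intro: smooth_on_linear[OF bounded_linear_inner_left])

lemma smooth_coord_fun:
  assumes chart: "(U, c) \<in> A" and b: "smooth_on UNIV b" "compact K" "K \<subseteq> c ` U"
    "\<And>z. z \<notin> K \<Longrightarrow> b z = 0"
  shows "smooth_fun A (coord_fun U c b x i)"
  unfolding coord_fun_def
  by (rule smooth_fun_extend_zero[OF chart, where K = K and F = "\<lambda>z. b z * ((z - c x) \<bullet> i)"])
    (auto intro!: smooth_on_mult smooth_on_affine chart_homeomorphism[OF chart] b
      intro: smooth_on_subset[OF b(1)])

text \<open>In the product rule at \<open>c x\<close> the derivative of \<open>b\<close> is
  multiplied by \<open>c x - c x\<close> and drops out, while \<open>b\<close> itself is 1. So the
  cut-off coordinate functions are dual to the coordinate fields at \<open>x\<close>.\<close>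

lemma coord_field_coord_fun:
  assumes chart: "(U, c) \<in> A" and b: "smooth_on UNIV b" "compact K" "K \<subseteq> c ` U"
    "\<And>z. z \<notin> K \<Longrightarrow> b z = 0" and x: "x \<in> U" "b (c x) = 1"
  shows "coord_field U c b i x (coord_fun U c b x j) = i \<bullet> j"
proof -
  have "(b has_derivative frechet_derivative b (at (c x))) (at (c x))"
    using b(1) by (auto intro: smooth_on_has_derivative)
  moreover have "((\<lambda>z. (z - c x) \<bullet> j) has_derivative (\<lambda>v. v \<bullet> j)) (at (c x))"
    by (auto intro!: derivative_eq_intros)
  ultimately have "((\<lambda>z. b z * ((z - c x) \<bullet> j)) has_derivative
      (\<lambda>v. b (c x) * (v \<bullet> j) + frechet_derivative b (at (c x)) v * ((c x - c x) \<bullet> j))) (at (c x))"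
    by (rule has_derivative_mult)
  then have "((\<lambda>z. coord_fun U c b x j (inv_into U c z)) has_derivative (\<lambda>v. v \<bullet> j)) (at (c x))"
    by (rule has_derivative_transform_within_open[where s = "c ` U", THEN has_derivative_eq_rhs])
      (use chart_homeomorphism[OF chart] x in
        \<open>auto simp: coord_fun_def chart_inverse[OF chart]\<close>)
  from frechet_derivative_at[OF this, symmetric] show ?thesis
    using smooth_coord_fun[OF chart b] x by (simp add: coord_field_def)
qed

text \<open>After a cut-off, Hadamard's lemma writes \<open>f\<close> minus its value at
  \<open>x\<close> as a sum of coordinates times smooth functions. The coordinates vanish at
  \<open>x\<close>, so the product rule leaves the values of \<open>v\<close> on them, weighted by
  the partial derivatives of \<open>f\<close>.\<close>

lemma tangent_expansion:
  assumes chart: "(U, c) \<in> A" and b: "smooth_on UNIV b" "compact K" "K \<subseteq> c ` U"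
    "\<And>z. z \<notin> K \<Longrightarrow> b z = 0" and x: "x \<in> U" "b (c x) = 1" and v: "v \<in> tangent_space A x"
  shows "v = (\<Sum>i\<in>Basis. v (coord_fun U c b x i) *\<^sub>R coord_field U c b i x)"
proof
  fix f
  let ?inv = "inv_into U c"
  show "v f = (\<Sum>i\<in>Basis. v (coord_fun U c b x i) *\<^sub>R coord_field U c b i x) f"
  proof (cases "smooth_fun A f")
    case False
    then have "coord_field U c b i x f = 0" for i
      by (simp add: coord_field_def)
    then show ?thesis
      using tangent_nonsmooth[OF v False] by (simp add: sum_fun_apply scaleR_fun_def)
  next
    case f: True
    define h where "h y = f y - f x" for y
    have h: "smooth_fun A h"
      unfolding h_def by (intro smooth_fun_diff smooth_fun_const f)
    have smh: "smooth_on (c ` U) (\<lambda>z. h (?inv z))"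
      by (rule smooth_fun_chart[OF h chart])
    \<comment> \<open>This is \<open>h\<close> in coordinates, cut off and extended by 0, since
      Hadamard's lemma is applied on the whole model space.\<close>
    define F where "F z = (if z \<in> c ` U then b z * h (?inv z) else 0)" for z
    have smF: "smooth_on UNIV F"
      unfolding F_def
      by (rule smooth_on_extend_zero[where K = K])
        (use b in \<open>auto intro!: smooth_on_mult chart_homeomorphism[OF chart] smh compact_imp_closed
          intro: smooth_on_subset[OF b(1)]\<close>)
    obtain G where smG: "\<And>i. smooth_on UNIV (G i)"
      and G0: "\<And>i. G i (c x) = frechet_derivative F (at (c x)) i"
      and FG: "\<And>z. F z = F (c x) + (\<Sum>i\<in>Basis. ((z - c x) \<bullet> i) * G i z)"
      using Hadamard_lemma[OF smF, of "c x"] by blast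
    define B where "B y = (if y \<in> U then b (c y) else 0)" for y
    define \<Gamma> where "\<Gamma> i y = (if y \<in> U then b (c y) * G i (c y) else 0)" for i y
    have B: "smooth_fun A B"
      unfolding B_def
      by (rule smooth_fun_extend_zero[OF chart, where K = K and F = b])
        (use b in \<open>auto intro: smooth_on_subset[OF b(1)]\<close>)
    have \<Gamma>: "smooth_fun A (\<Gamma> i)" for i
      unfolding \<Gamma>_def
      by (rule smooth_fun_extend_zero[OF chart, where K = K and F = "\<lambda>z. b z * G i z"])
        (use b in \<open>auto intro!: smooth_on_mult chart_homeomorphism[OF chart]
          intro: smooth_on_subset[OF b(1)] smooth_on_subset[OF smG]\<close>)
    have coord: "smooth_fun A (coord_fun U c b x i)" for i
      by (rule smooth_coord_fun[OF chart b])
    \<comment> \<open>Three factors \<open>B\<close> are spent: one turns \<open>h\<close> into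
      \<open>F\<close>, the other two cut off the coordinate function and \<open>G i\<close>. As
      \<open>B x = 1\<close> and \<open>h x = 0\<close>, they do not change the value of
      \<open>v\<close>.\<close>
    have "h y * (B y * (B y * B y)) = (\<Sum>i\<in>Basis. coord_fun U c b x i y * \<Gamma> i y)" for y
    proof (cases "y \<in> U")
      case True
      have "b (c y) * h y = (\<Sum>i\<in>Basis. ((c y - c x) \<bullet> i) * G i (c y))"
        using FG[of "c y"] x True by (simp add: F_def chart_inverse[OF chart] h_def)
      then have "b (c y) * b (c y) * (b (c y) * h y) =
          (\<Sum>i\<in>Basis. b (c y) * b (c y) * (((c y - c x) \<bullet> i) * G i (c y)))"
        by (simp add: sum_distrib_left)
      then show ?thesis
        using True by (simp add: B_def \<Gamma>_def coord_fun_def mult_ac)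
    qed (simp add: B_def \<Gamma>_def)
    then have "v (\<lambda>y. h y * (B y * (B y * B y))) = v (\<lambda>y. \<Sum>i\<in>Basis. coord_fun U c b x i y * \<Gamma> i y)"
      by presburger
    moreover have "v (\<lambda>y. h y * (B y * (B y * B y))) = v f"
    proof -
      have "v h = v f"
        using tangent_diff[OF v f smooth_fun_const, of "f x"] tangent_const[OF v]
        by (simp add: h_def[abs_def])
      then show ?thesis
        using x B h by (subst tangent_mult[OF v h]) (auto simp: smooth_fun_mult h_def[of x] B_def[of x])
    qed
    moreover have "v (\<lambda>y. \<Sum>i\<in>Basis. coord_fun U c b x i y * \<Gamma> i y) =
        (\<Sum>i\<in>Basis. G i (c x) * v (coord_fun U c b x i))"
    proof -
      have "v (\<lambda>y. coord_fun U c b x i y * \<Gamma> i y) = G i (c x) * v (coord_fun U c b x i)" for i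
        using x by (subst tangent_mult[OF v coord \<Gamma>]) (simp add: coord_fun_def[of U c b x i] \<Gamma>_def[of i x])
      then show ?thesis
        by (subst tangent_sum[OF v]) (auto intro: smooth_fun_mult coord \<Gamma>)
    qed
    \<comment> \<open>Since \<open>h\<close> vanishes at \<open>x\<close> and
      \<open>b (c x) = 1\<close>, the cut-off does not affect the derivative at
      \<open>c x\<close>.\<close>
    moreover have "G i (c x) = coord_field U c b i x f" for i
    proof -
      have "(b has_derivative frechet_derivative b (at (c x))) (at (c x))"
        using b(1) by (auto intro: smooth_on_has_derivative)
      moreover have "((\<lambda>z. h (?inv z)) has_derivative frechet_derivative (\<lambda>z. f (?inv z)) (at (c x))) (at (c x))"
        unfolding h_def
        using has_derivative_diff[OF smooth_on_has_derivative[OF smooth_fun_chart[OF f chart]] has_derivative_const] x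
        by fastforce
      ultimately have "((\<lambda>z. b z * h (?inv z)) has_derivative
          (\<lambda>v. b (c x) * frechet_derivative (\<lambda>z. f (?inv z)) (at (c x)) v
            + frechet_derivative b (at (c x)) v * h (?inv (c x)))) (at (c x))"
        by (rule has_derivative_mult)
      then have "(F has_derivative frechet_derivative (\<lambda>z. f (?inv z)) (at (c x))) (at (c x))"
        by (rule has_derivative_transform_within_open[where s = "c ` U", THEN has_derivative_eq_rhs])
          (use chart_homeomorphism[OF chart] x in \<open>auto simp: F_def chart_inverse[OF chart] h_def\<close>)
      from frechet_derivative_at[OF this, symmetric] show ?thesis
        using f x by (simp add: G0 coord_field_def)
    qed
    ultimately show ?thesis
      by (simp add: sum_fun_apply scaleR_fun_def mult.commute)
  qed
qed

section \<open>The module of vector fields, and bases of the tangent spaces\<close>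

lemma vector_fields_at: "X \<in> vector_fields A \<Longrightarrow> X x \<in> tangent_space A x"
  by (simp add: vector_fields_def)

lemma vector_fields_smooth: "X \<in> vector_fields A \<Longrightarrow> smooth_fun A f \<Longrightarrow> smooth_fun A (\<lambda>x. X x f)"
  by (simp add: vector_fields_def)

lemma vector_fields_add: "X \<in> vector_fields A \<Longrightarrow> Y \<in> vector_fields A \<Longrightarrow> X + Y \<in> vector_fields A"
  by (auto simp: vector_fields_def intro: subspace_add[OF subspace_tangent_space] smooth_fun_add)

lemma vector_fields_fmul: "smooth_fun A f \<Longrightarrow> X \<in> vector_fields A \<Longrightarrow> fmul f X \<in> vector_fields A"
  by (auto simp: vector_fields_def fmul_def intro: subspace_scale[OF subspace_tangent_space])
    (simp add: scaleR_fun_def smooth_fun_mult)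

lemma vector_fields_zero: "0 \<in> vector_fields A"
  by (auto simp: vector_fields_def intro: subspace_0[OF subspace_tangent_space] smooth_fun_const)

lemma vector_fields_minus: "X \<in> vector_fields A \<Longrightarrow> - X \<in> vector_fields A"
  by (auto simp: vector_fields_def intro: subspace_neg[OF subspace_tangent_space] smooth_fun_minus)

lemma vector_fields_diff: "X \<in> vector_fields A \<Longrightarrow> Y \<in> vector_fields A \<Longrightarrow> X - Y \<in> vector_fields A"
  using vector_fields_add[OF _ vector_fields_minus] by simp

lemma vector_fields_sum:
  "(\<And>i. i \<in> I \<Longrightarrow> X i \<in> vector_fields A) \<Longrightarrow> (\<Sum>i\<in>I. X i) \<in> vector_fields A"
  by (induction I rule: infinite_finite_induct) (auto intro: vector_fields_zero vector_fields_add)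

text \<open>The coordinate fields at \<open>x\<close> are independent by duality with the coordinate
  functions, and they span by the expansion above. As they are global, combinations with constant
  coefficients realise every tangent vector at \<open>x\<close>.\<close>

lemma tangent_space_basis:
  obtains B where "finite B" "independent B" "span B = tangent_space A x" "card B = m"
    "\<And>v. v \<in> tangent_space A x \<Longrightarrow> \<exists>X\<in>vector_fields A. X x = v"
proof -
  obtain U c where chart: "(U, c) \<in> A" and x: "x \<in> U"
    by (rule chart_at)
  obtain b K where b: "smooth_on UNIV b" "compact K" "K \<subseteq> c ` U" "\<And>z. z \<notin> K \<Longrightarrow> b z = 0"
    and bx: "b (c x) = (1::real)"
    using exists_bump[OF chart_homeomorphism(2)[OF chart], of "c x"] x by (metis imageI)
  let ?\<delta> = "\<lambda>i. coord_field U c b i" and ?\<xi> = "coord_fun U c b x"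
  have dual: "?\<delta> i x (?\<xi> j) = i \<bullet> j" for i j
    by (rule coord_field_coord_fun[OF chart b x bx])
  have field: "?\<delta> i \<in> vector_fields A" for i
    by (rule coord_field_vector_field[OF chart b])
  have expand: "v = (\<Sum>i\<in>Basis. v (?\<xi> i) *\<^sub>R ?\<delta> i x)" if "v \<in> tangent_space A x" for v
    by (rule tangent_expansion[OF chart b x bx that])
  define B where "B = (\<lambda>i. ?\<delta> i x) ` Basis"
  have inj: "inj_on (\<lambda>i. ?\<delta> i x) Basis"
    by (rule inj_onI) (metis dual inner_Basis zero_neq_one)
  have scalars: "k v = 0" if sum0: "(\<Sum>v\<in>B. k v *\<^sub>R v) = 0" and "v \<in> B" for k v
  proof -
    from \<open>v \<in> B\<close> obtain j where j: "j \<in> Basis" "v = ?\<delta> j x"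
      by (auto simp: B_def)
    have "(\<Sum>i\<in>Basis. k (?\<delta> i x) *\<^sub>R ?\<delta> i x) (?\<xi> j) = 0"
      using sum0 by (simp add: B_def sum.reindex[OF inj])
    then have "(\<Sum>i\<in>Basis. k (?\<delta> i x) * (i \<bullet> j)) = 0"
      by (simp add: sum_fun_apply scaleR_fun_def dual)
    then show "k v = 0"
      using j by (simp add: inner_Basis if_distrib cong: if_cong)
  qed
  have "finite B"
    by (simp add: B_def)
  have "independent B"
  proof
    assume "dependent B"
    then obtain k w where "(\<Sum>v\<in>B. k v *\<^sub>R v) = 0" "w \<in> B" "k w \<noteq> 0"
      using dependent_finite[OF \<open>finite B\<close>] by auto
    then show False
      using scalars[of k w] by simp
  qed
  moreover have "span B = tangent_space A x"
  proof (rule subset_antisym)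
    show "span B \<subseteq> tangent_space A x"
      by (rule span_minimal[OF _ subspace_tangent_space]) (auto simp: B_def vector_fields_at[OF field])
    show "tangent_space A x \<subseteq> span B"
    proof
      fix v assume v: "v \<in> tangent_space A x"
      show "v \<in> span B"
        by (subst expand[OF v], intro span_sum span_scale span_base) (simp add: B_def)
    qed
  qed
  moreover have "card B = m"
    by (simp add: B_def card_image[OF inj] dim_model)
  moreover have "\<exists>X\<in>vector_fields A. X x = v" if "v \<in> tangent_space A x" for v
  proof
    let ?X = "\<Sum>i\<in>Basis. fmul (\<lambda>_. v (?\<xi> i)) (?\<delta> i)"
    show "?X \<in> vector_fields A"
      by (intro vector_fields_sum vector_fields_fmul smooth_fun_const field)
    show "?X x = v"
      using expand[OF that, symmetric] by (simp add: sum_fun_apply fmul_def)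
  qed
  ultimately show ?thesis
    using that[of B] by (simp add: B_def)
qed

lemma extend_vec:
  assumes "v \<in> tangent_space A x"
  shows "extend_vec A x v \<in> vector_fields A" "extend_vec A x v x = v"
proof -
  have "\<exists>X. X \<in> vector_fields A \<and> X x = v"
    using tangent_space_basis[of x] assms by metis
  from someI_ex[OF this] show "extend_vec A x v \<in> vector_fields A" "extend_vec A x v x = v"
    by (auto simp: extend_vec_def)
qed

text \<open>Traces are computed in bases picked by a choice operator; this controls whichever basis
  is picked.\<close>

lemma card_tangent_basis:
  assumes "independent B" "span B = tangent_space A x"
  shows "finite B" "card B = m"
proof -
  obtain B' where B': "finite B'" "independent B'" "span B' = tangent_space A x" "card B' = m"
    using tangent_space_basis by metis
  have "B \<subseteq> span B'"
    using span_superset[of B] assms B' by auto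
  then show "finite B"
    using independent_span_bound[OF B'(1) assms(1)] by simp
  show "card B = m"
    using B' assms dim_eq_card[of B "tangent_space A x"] dim_eq_card[of B' "tangent_space A x"]
    by (metis span_span)
qed

end

section \<open>Traces\<close>

lemma linear_on_set_add:
  "linear_on_set S f \<Longrightarrow> u \<in> S \<Longrightarrow> v \<in> S \<Longrightarrow> f (u + v) = f u + f v"
  by (simp add: linear_on_set_def)

lemma linear_on_set_scale: "linear_on_set S f \<Longrightarrow> u \<in> S \<Longrightarrow> f (c *\<^sub>R u) = c *\<^sub>R f u"
  by (simp add: linear_on_set_def)

lemma linear_on_set_zero: "linear_on_set S f \<Longrightarrow> u \<in> S \<Longrightarrow> f 0 = 0"
  using linear_on_set_scale[of S f u 0] by simp

lemma linear_on_set_minus: "linear_on_set S f \<Longrightarrow> u \<in> S \<Longrightarrow> f (- u) = - f u"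
  using linear_on_set_scale[of S f u "- 1"] by simp

lemma linear_on_set_diff:
  "linear_on_set S f \<Longrightarrow> subspace S \<Longrightarrow> u \<in> S \<Longrightarrow> v \<in> S \<Longrightarrow> f (u - v) = f u - f v"
  using linear_on_set_add[of S f u "- v"] linear_on_set_minus[of S f v] by (simp add: subspace_neg)

lemma linear_on_set_sum:
  assumes "linear_on_set S f" "subspace S" "\<And>i. i \<in> I \<Longrightarrow> u i \<in> S"
  shows "f (\<Sum>i\<in>I. u i) = (\<Sum>i\<in>I. f (u i))"
  using assms(3)
proof (induction I rule: infinite_finite_induct)
  case (insert i I)
  then show ?case
    by (simp add: linear_on_set_add[OF assms(1)] subspace_sum[OF assms(2)])
qed (use linear_on_set_zero[OF assms(1) subspace_0[OF assms(2)]] in auto)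

text \<open>The basis chosen inside \<open>trace_on\<close> depends on \<open>S\<close> alone, so
  traces of different maps can be compared in one basis, with no appeal to basis
  independence.\<close>

lemma trace_on_basis:
  fixes S :: "'v::real_vector set"
  assumes "subspace S"
  obtains B where "independent B" "span B = S"
    "\<And>F. trace_on S F = (\<Sum>b\<in>B. representation B (F b) b)"
proof -
  define B where "B = (SOME B. independent B \<and> span B = S)"
  have "\<exists>B. independent B \<and> span B = S"
    using basis_exists[of S] span_minimal[OF _ assms] by (metis subset_antisym)
  from someI_ex[OF this] have "independent B" "span B = S"
    by (simp_all add: B_def)
  then show ?thesis
    using that[of B] by (simp add: trace_on_def Let_def B_def)
qed

lemma trace_on_cong:
  assumes "subspace S" "\<And>u. u \<in> S \<Longrightarrow> F u = G u"
  shows "trace_on S F = trace_on S G"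
proof -
  obtain B where B: "span B = S" "\<And>F. trace_on S F = (\<Sum>b\<in>B. representation B (F b) b)"
    using trace_on_basis[OF assms(1)] by metis
  then have "B \<subseteq> S"
    using span_superset by blast
  then show ?thesis
    using assms(2) by (auto simp: B(2) intro!: sum.cong)
qed

lemma trace_on_add:
  assumes "subspace S" "\<And>u. u \<in> S \<Longrightarrow> F u \<in> S" "\<And>u. u \<in> S \<Longrightarrow> G u \<in> S"
  shows "trace_on S (\<lambda>u. F u + G u) = trace_on S F + trace_on S G"
proof -
  obtain B where B: "independent B" "span B = S"
    "\<And>F. trace_on S F = (\<Sum>b\<in>B. representation B (F b) b)"
    using trace_on_basis[OF assms(1)] by metis
  have "representation B (F b + G b) b = representation B (F b) b + representation B (G b) b"
    if "b \<in> B" for b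
  proof -
    have "b \<in> S"
      using that B(2) span_superset by blast
    then show ?thesis
      using assms by (simp add: representation_add[OF B(1)] B(2))
  qed
  then show ?thesis
    by (simp add: B(3) sum.distrib)
qed

lemma trace_on_scale:
  assumes "subspace S" "\<And>B. independent B \<Longrightarrow> span B = S \<Longrightarrow> card B = m"
  shows "trace_on S (\<lambda>u. c *\<^sub>R u) = c * real m"
proof -
  obtain B where B: "independent B" "span B = S"
    "\<And>F. trace_on S F = (\<Sum>b\<in>B. representation B (F b) b)"
    using trace_on_basis[OF assms(1)] by metis
  have "representation B (c *\<^sub>R b) b = c" if "b \<in> B" for b
    using that B(1) span_base[OF that] by (simp add: representation_scale representation_basis)
  then show ?thesis
    using assms(2)[OF B(1,2)] by (simp add: B(3))
qed

text \<open>The diagonal entry at \<open>b\<close> is \<open>k b\<close> times the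
  \<open>b\<close>-coordinate of \<open>v\<close>; linearity of \<open>k\<close> sums these entries
  to \<open>k v\<close>.\<close>

lemma trace_on_rank_one:
  assumes "subspace S" "\<And>B. independent B \<Longrightarrow> span B = S \<Longrightarrow> finite B"
    and "linear_on_set S k" "v \<in> S"
  shows "trace_on S (\<lambda>u. k u *\<^sub>R v) = k v"
proof -
  obtain B where B: "independent B" "span B = S"
    "\<And>F. trace_on S F = (\<Sum>b\<in>B. representation B (F b) b)"
    using trace_on_basis[OF assms(1)] by metis
  have BS: "B \<subseteq> S"
    using B(2) span_superset by blast
  have "k v = k (\<Sum>b\<in>B. representation B v b *\<^sub>R b)"
    using sum_representation_eq[OF B(1), of v B] assms(2)[OF B(1,2)] assms(4) B(2) by simp
  also have "\<dots> = (\<Sum>b\<in>B. k (representation B v b *\<^sub>R b))"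
    using BS by (intro linear_on_set_sum[OF assms(3,1)] subspace_scale[OF assms(1)]) auto
  also have "\<dots> = (\<Sum>b\<in>B. representation B (k b *\<^sub>R v) b)"
  proof (rule sum.cong)
    fix b assume "b \<in> B"
    then have "b \<in> S" using BS by auto
    then show "k (representation B v b *\<^sub>R b) = representation B (k b *\<^sub>R v) b"
      using linear_on_set_scale[OF assms(3)] representation_scale[OF B(1), of v "k b"] assms(4) B(2)
      by simp
  qed simp
  finally show ?thesis
    by (simp add: B(3))
qed

section \<open>Inner products, orthonormal bases and metric traces\<close>

locale inner_product_on =
  fixes S :: "'v::real_vector set" and h :: "'v \<Rightarrow> 'v \<Rightarrow> real"
  assumes subspace: "subspace S"
    and linear: "u \<in> S \<Longrightarrow> linear_on_set S (h u)"
    and sym: "u \<in> S \<Longrightarrow> v \<in> S \<Longrightarrow> h u v = h v u"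
    and pos: "u \<in> S \<Longrightarrow> u \<noteq> 0 \<Longrightarrow> h u u > 0"
begin

lemma linear_left: "v \<in> S \<Longrightarrow> linear_on_set S (\<lambda>u. h u v)"
  using linear[of v] by (simp add: linear_on_set_def sym subspace_add[OF subspace] subspace_scale[OF subspace])

definition orthonormal :: "'v set \<Rightarrow> bool" where
  "orthonormal E \<longleftrightarrow> (\<forall>u\<in>E. \<forall>v\<in>E. h u v = (if u = v then 1 else 0))"

lemma inner_orthonormal_sum:
  assumes "finite E" "E \<subseteq> S" "orthonormal E" "e \<in> E"
  shows "h (\<Sum>d\<in>E. k d *\<^sub>R d) e = k e"
proof -
  have "h (\<Sum>d\<in>E. k d *\<^sub>R d) e = (\<Sum>d\<in>E. h (k d *\<^sub>R d) e)"
    using assms by (intro linear_on_set_sum[OF linear_left subspace] subspace_scale[OF subspace]) auto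
  also have "\<dots> = (\<Sum>d\<in>E. if d = e then k d else 0)"
    using assms by (intro sum.cong) (auto simp: linear_on_set_scale[OF linear_left] orthonormal_def subset_iff)
  finally show ?thesis
    using assms by simp
qed

lemma orthonormal_independent:
  assumes "finite E" "E \<subseteq> S" "orthonormal E"
  shows "independent E"
proof
  assume "dependent E"
  then obtain k w where "(\<Sum>v\<in>E. k v *\<^sub>R v) = 0" "w \<in> E" "k w \<noteq> 0"
    using dependent_finite[OF assms(1)] by auto
  then show False
    using inner_orthonormal_sum[OF assms, of w k] linear_on_set_zero[OF linear_left] assms(2) by auto
qed

lemma orthonormal_expansion:
  assumes "finite E" "orthonormal E" "span E = S" "v \<in> S"
  shows "v = (\<Sum>e\<in>E. h v e *\<^sub>R e)"
proof -
  have ES: "E \<subseteq> S"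
    using assms(3) span_superset by blast
  obtain k where v: "v = (\<Sum>e\<in>E. k e *\<^sub>R e)"
    using assms(3,4) span_finite[OF assms(1)] by auto
  show ?thesis
    using inner_orthonormal_sum[OF assms(1) ES assms(2)] by (subst v, subst v) simp
qed

lemma Gram_Schmidt:
  assumes "finite B" "B \<subseteq> S"
  obtains E where "finite E" "E \<subseteq> S" "orthonormal E" "span E = span B"
proof -
  have "\<exists>E. finite E \<and> E \<subseteq> S \<and> orthonormal E \<and> span E = span B"
    using assms
  proof (induction B rule: finite_induct)
    case empty
    then show ?case by (auto simp: orthonormal_def intro!: exI[of _ "{}"])
  next
    case (insert b B)
    then obtain E where E: "finite E" "E \<subseteq> S" "orthonormal E" "span E = span B"
      by auto
    \<comment> \<open>\<open>p\<close> is the orthogonal projection of \<open>b\<close> onto the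
      span of \<open>E\<close>; the remainder \<open>u\<close> is normalised and added to
      \<open>E\<close>, or dropped if it is 0.\<close>
    define p where "p = (\<Sum>e\<in>E. h b e *\<^sub>R e)"
    define u where "u = b - p"
    have b: "b \<in> S" using insert by simp
    have p: "p \<in> span E"
      unfolding p_def by (intro span_sum span_scale span_base)
    then have pS: "p \<in> S"
      using span_minimal[OF E(2) subspace] by blast
    have u: "u \<in> S"
      unfolding u_def using b pS by (rule subspace_diff[OF subspace])
    have orth: "h u e = 0" if "e \<in> E" for e
    proof -
      have "h u e = h b e - h p e"
        using that E(2) b pS by (auto simp: u_def intro!: linear_on_set_diff[OF linear_left subspace])
      then show ?thesis
        using inner_orthonormal_sum[OF E(1-3) that] by (simp add: p_def)
    qed
    have span_b: "span (insert b B) = span (insert u E)"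
      using eq_span_insert_eq[of b u E] p by (simp add: u_def span_insert E(4))
    show ?case
    proof (cases "u = 0")
      case True
      then have "span (insert b B) = span E"
        using span_b by simp
      then show ?thesis using E by auto
    next
      case False
      define c where "c = 1 / sqrt (h u u)"
      have c: "c \<noteq> 0" "c * c * h u u = 1"
        using pos[OF u False] by (auto simp: c_def)
      have cu: "c *\<^sub>R u \<in> S"
        by (rule subspace_scale[OF subspace u])
      have scale: "h (c *\<^sub>R u) e = c * h u e" if "e \<in> S" for e
        using linear_on_set_scale[OF linear_left[OF that] u] by simp
      have "orthonormal (insert (c *\<^sub>R u) E)"
      proof -
        have "h (c *\<^sub>R u) (c *\<^sub>R u) = 1"
          using scale[OF cu] linear_on_set_scale[OF linear[OF u] u] c(2) by simp
        moreover have "h (c *\<^sub>R u) e = 0" "h e (c *\<^sub>R u) = 0" if "e \<in> E" for e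
          using scale orth[OF that] sym[OF cu] that E(2) by auto
        ultimately show ?thesis
          using E(3) by (auto simp: orthonormal_def)
      qed
      moreover have "span (insert (c *\<^sub>R u) E) = span (insert u E)"
      proof -
        have "(\<exists>k. x - k *\<^sub>R (c *\<^sub>R u) \<in> span E) \<longleftrightarrow> (\<exists>k. x - k *\<^sub>R u \<in> span E)" for x
          using c(1) by (metis nonzero_divide_eq_eq scaleR_scaleR)
        then show ?thesis by (simp add: span_insert)
      qed
      ultimately show ?thesis
        using E cu span_b by (intro exI[of _ "insert (c *\<^sub>R u) E"]) auto
    qed
  qed
  then show ?thesis using that by blast
qed

text \<open>Each \<open>F b\<close> is expanded in an orthonormal \<open>E\<close> and the sums are
  exchanged. Skewness moves \<open>F\<close> from \<open>b\<close> to \<open>e\<close>, the sum over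
  \<open>B\<close> then collapses to \<open>e\<close>, and the remaining terms - h(e, F e) vanish by
  skewness again.\<close>

lemma trace_on_skew:
  assumes fin: "\<And>B. independent B \<Longrightarrow> span B = S \<Longrightarrow> finite B"
    and F: "\<And>u. u \<in> S \<Longrightarrow> F u \<in> S"
    and skew: "\<And>u v. u \<in> S \<Longrightarrow> v \<in> S \<Longrightarrow> h (F u) v = - h u (F v)"
  shows "trace_on S F = 0"
proof -
  obtain B where B: "independent B" "span B = S"
    "\<And>F. trace_on S F = (\<Sum>b\<in>B. representation B (F b) b)"
    using trace_on_basis[OF subspace] by metis
  have BS: "B \<subseteq> S"
    using B(2) span_superset by blast
  obtain E where E: "finite E" "E \<subseteq> S" "orthonormal E" "span E = S"
    using Gram_Schmidt[OF fin[OF B(1,2)] BS] B(2) by metis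
  have diag: "h e (F e) = 0" if "e \<in> S" for e
    using skew[OF that that] sym[OF F[OF that] that] by simp
  have "representation B (F b) b = (\<Sum>e\<in>E. representation B e b * h (F b) e)" if "b \<in> B" for b
  proof -
    have "F b \<in> S" using that BS F by auto
    then have "representation B (F b) b = representation B (\<Sum>e\<in>E. h (F b) e *\<^sub>R e) b"
      using orthonormal_expansion[OF E(1,3,4)] by metis
    also have "\<dots> = (\<Sum>e\<in>E. representation B (h (F b) e *\<^sub>R e) b)"
      using E(2) by (subst representation_sum[OF B(1)]) (auto simp: B(2) intro!: subspace_scale[OF subspace])
    also have "\<dots> = (\<Sum>e\<in>E. representation B e b * h (F b) e)"
      using E(2) by (intro sum.cong refl) (subst representation_scale[OF B(1)], auto simp: B(2))
    finally show ?thesis .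
  qed
  then have "trace_on S F = (\<Sum>b\<in>B. \<Sum>e\<in>E. representation B e b * h (F b) e)"
    by (simp add: B(3))
  also have "\<dots> = (\<Sum>e\<in>E. \<Sum>b\<in>B. representation B e b * h (F b) e)"
    by (rule sum.swap)
  also have "\<dots> = (\<Sum>e\<in>E. - h (\<Sum>b\<in>B. representation B e b *\<^sub>R b) (F e))"
  proof (rule sum.cong)
    fix e assume "e \<in> E"
    then have e: "e \<in> S" using E(2) by auto
    have "h (\<Sum>b\<in>B. representation B e b *\<^sub>R b) (F e) = (\<Sum>b\<in>B. h (representation B e b *\<^sub>R b) (F e))"
      using BS by (intro linear_on_set_sum[OF linear_left[OF F[OF e]] subspace] subspace_scale[OF subspace]) auto
    also have "\<dots> = (\<Sum>b\<in>B. - (representation B e b * h (F b) e))"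
      using BS linear_on_set_scale[OF linear_left[OF F[OF e]]] skew[OF _ e]
      by (intro sum.cong) (auto simp: subset_iff)
    finally show "(\<Sum>b\<in>B. representation B e b * h (F b) e) = - h (\<Sum>b\<in>B. representation B e b *\<^sub>R b) (F e)"
      by (simp add: sum_negf)
  qed simp
  also have "\<dots> = (\<Sum>e\<in>E. - h e (F e))"
    using E(2) B(2) sum_representation_eq[OF B(1) _ fin[OF B(1,2)]] by (intro sum.cong) (auto simp: subset_iff)
  also have "\<dots> = 0"
    using E(2) diag by (intro sum.neutral) auto
  finally show ?thesis .
qed

text \<open>Gram-Schmidt provides a witness for the choice inside \<open>metric_trace_on\<close>, so
  the chosen basis is orthonormal. One \<open>E\<close> serves all bilinear forms.\<close>

lemma metric_trace_on_basis:
  assumes "\<And>B. independent B \<Longrightarrow> span B = S \<Longrightarrow> finite B"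
  obtains E where "finite E" "E \<subseteq> S" "orthonormal E" "span E = S" "\<forall>b. metric_trace_on S h b = (\<Sum>e\<in>E. b e e)"
proof -
  let ?P = "\<lambda>B. independent B \<and> span B = S \<and> (\<forall>u\<in>B. \<forall>v\<in>B. h u v = (if u = v then 1 else 0))"
  define E where "E = (SOME B. ?P B)"
  obtain B where B: "independent B" "span B = S"
    using trace_on_basis[OF subspace] by metis
  then have "B \<subseteq> S"
    using span_superset by blast
  with Gram_Schmidt[OF assms[OF B]] B(2) obtain E' where "finite E'" "E' \<subseteq> S" "orthonormal E'" "span E' = S"
    by metis
  then have "?P E'"
    using orthonormal_independent by (auto simp: orthonormal_def)
  then have E: "?P E"
    unfolding E_def by (rule someI)
  then have "finite E"
    using assms by auto
  moreover have "E \<subseteq> S"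
    using E span_superset by blast
  moreover have "orthonormal E" "span E = S"
    using E by (simp_all add: orthonormal_def)
  moreover have "\<forall>b. metric_trace_on S h b = (\<Sum>e\<in>E. b e e)"
    unfolding metric_trace_on_def Let_def E_def by (rule allI) (rule refl)
  ultimately show ?thesis
    by (rule that)
qed

end

section \<open>Curvature of the Levi-Civita connection\<close>

context smooth_mfd
begin

text \<open>The mixed terms (X f)(Y h) + (X h)(Y f) of the product rule are symmetric in the two
  fields and cancel in the commutator.\<close>

lemma bracket_vector_field:
  assumes X: "X \<in> vector_fields A" and Y: "Y \<in> vector_fields A"
  shows "bracket X Y \<in> vector_fields A"
proof -
  note smooth = vector_fields_smooth[OF X] vector_fields_smooth[OF Y]
  have "bracket X Y x \<in> tangent_space A x" for x
  proof (rule tangent_spaceI)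
    note Xx = vector_fields_at[OF X, of x] and Yx = vector_fields_at[OF Y, of x]
    note Xy = vector_fields_at[OF X] and Yy = vector_fields_at[OF Y]
    show "bracket X Y x f = 0" if "\<not> smooth_fun A f" for f
      by (simp add: bracket_def tangent_nonsmooth[OF Xy that] tangent_nonsmooth[OF Yy that]
          tangent_const[OF Xx] tangent_const[OF Yx])
    fix f assume f: "smooth_fun A f"
    show "bracket X Y x (\<lambda>y. k * f y) = k * bracket X Y x f" for k
      by (simp add: bracket_def tangent_scale[OF Xy] tangent_scale[OF Yy] f smooth algebra_simps)
    fix h assume h: "smooth_fun A h"
    show "bracket X Y x (\<lambda>y. f y + h y) = bracket X Y x f + bracket X Y x h"
      by (simp add: bracket_def tangent_add[OF Xy] tangent_add[OF Yy] f h smooth)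
    show "bracket X Y x (\<lambda>y. f y * h y) = f x * bracket X Y x h + h x * bracket X Y x f"
      by (simp add: bracket_def tangent_mult[OF Xy] tangent_mult[OF Yy] f h smooth
          tangent_add[OF Xy] tangent_add[OF Yy] smooth_fun_mult algebra_simps)
  qed
  moreover have "smooth_fun A (\<lambda>x. bracket X Y x f)" if "smooth_fun A f" for f
    using that by (simp add: bracket_def smooth smooth_fun_diff)
  ultimately show ?thesis
    by (simp add: vector_fields_def)
qed

lemma Jacobi_identity:
  assumes "X \<in> vector_fields A" "Y \<in> vector_fields A" "Z \<in> vector_fields A"
  shows "bracket X (bracket Y Z) + bracket Y (bracket Z X) + bracket Z (bracket X Y) = 0"
proof (intro ext)
  fix x f
  note at = assms[THEN vector_fields_at]
  note smooth = assms[THEN vector_fields_smooth]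
  show "(bracket X (bracket Y Z) + bracket Y (bracket Z X) + bracket Z (bracket X Y)) x f = 0 x f"
  \<comment> \<open>Additivity of derivations is available for smooth functions; on other functions
    every bracket is 0 by convention.\<close>
  proof (cases "smooth_fun A f")
    case True
    then show ?thesis
      by (simp add: bracket_def at[THEN tangent_diff] smooth)
  next
    case False
    have zero: "bracket P (bracket Q R) x f = 0"
      if "P \<in> vector_fields A" "Q \<in> vector_fields A" "R \<in> vector_fields A" for P Q R
      by (intro tangent_nonsmooth[OF vector_fields_at False] bracket_vector_field that)
    show ?thesis
      using assms by (simp add: zero)
  qed
qed

lemma fmul_at [simp]: "fmul f X x = f x *\<^sub>R X x"
  by (simp add: fmul_def)

lemma fmul_minus_one [simp]: "fmul (\<lambda>_. - 1) X = - X"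
  by (auto simp: fmul_def fun_eq_iff)

end

section \<open>The Levi-Civita connection: Bianchi identity, skew curvature, symmetric Ricci
  tensor\<close>

locale riemannian_mfd = smooth_mfd A m
  for A :: "('a::{t2_space,second_countable_topology}, 'e::euclidean_space) chart set" and m +
  fixes g :: "'a bilin_field" and D :: "'a connection"
  assumes riemannian_metric: "riemannian_metric A g"
    and levi_civita: "levi_civita A g D"
begin

sublocale metric: inner_product_on "tangent_space A x" "g x" for x
  using riemannian_metric subspace_tangent_space
  by unfold_locales (auto simp: riemannian_metric_def)

lemma finite_tangent_basis: "independent B \<Longrightarrow> span B = tangent_space A x \<Longrightarrow> finite B"
  by (rule card_tangent_basis)

lemma smooth_metric:
  "X \<in> vector_fields A \<Longrightarrow> Y \<in> vector_fields A \<Longrightarrow> smooth_fun A (\<lambda>x. g x (X x) (Y x))"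
  using riemannian_metric by (simp add: riemannian_metric_def)

lemma connection:
  assumes "X \<in> vector_fields A" "Y \<in> vector_fields A"
  shows "D X Y \<in> vector_fields A"
    and "Z \<in> vector_fields A \<Longrightarrow> D (X + Z) Y = D X Y + D Z Y"
    and "Z \<in> vector_fields A \<Longrightarrow> D X (Y + Z) = D X Y + D X Z"
    and "smooth_fun A f \<Longrightarrow> D (fmul f X) Y = fmul f (D X Y)"
    and "smooth_fun A f \<Longrightarrow> D X (fmul f Y) = fmul f (D X Y) + fmul (\<lambda>x. X x f) Y"
  using levi_civita assms by (auto simp: levi_civita_def affine_connection_def)

lemma connection_minus:
  assumes "X \<in> vector_fields A" "Y \<in> vector_fields A"
  shows "D X (- Y) = - D X Y"
proof -
  have "fmul (\<lambda>x. X x (\<lambda>_. - 1)) Y = 0"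
    using tangent_const[OF vector_fields_at[OF assms(1)]] by (auto simp: fmul_def fun_eq_iff)
  then show ?thesis
    using connection(5)[OF assms smooth_fun_const[of "- 1"]] by simp
qed

lemma connection_diff:
  assumes "X \<in> vector_fields A" "Y \<in> vector_fields A" "Z \<in> vector_fields A"
  shows "D X (Y - Z) = D X Y - D X Z"
  using connection(3)[OF assms(1,2) vector_fields_minus[OF assms(3)]] connection_minus[OF assms(1,3)]
  by simp

lemma torsion_free:
  "X \<in> vector_fields A \<Longrightarrow> Y \<in> vector_fields A \<Longrightarrow> D X Y - D Y X = bracket X Y"
  using levi_civita by (auto simp: levi_civita_def torsion_def)

lemma bracket_at:
  "X \<in> vector_fields A \<Longrightarrow> Y \<in> vector_fields A \<Longrightarrow> bracket X Y x = D X Y x - D Y X x"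
  by (simp flip: torsion_free)

lemma metric_compatible:
  "X \<in> vector_fields A \<Longrightarrow> Y \<in> vector_fields A \<Longrightarrow> Z \<in> vector_fields A \<Longrightarrow>
    X x (\<lambda>y. g y (Y y) (Z y)) = g x (D X Y x) (Z x) + g x (Y x) (D X Z x)"
  using levi_civita by (auto simp: levi_civita_def)

lemma curvature_vector_field:
  assumes "X \<in> vector_fields A" "Y \<in> vector_fields A" "Z \<in> vector_fields A"
  shows "curvature D X Y Z \<in> vector_fields A"
  unfolding curvature_def
  by (intro vector_fields_diff connection(1) bracket_vector_field assms)

text \<open>Torsion-freeness collects the nine terms into three groups, each equal to a double
  bracket; the Jacobi identity makes their sum 0.\<close>

lemma Bianchi_identity:
  assumes X: "X \<in> vector_fields A" and Y: "Y \<in> vector_fields A" and Z: "Z \<in> vector_fields A"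
  shows "curvature D X Y Z + curvature D Y Z X + curvature D Z X Y = 0"
proof -
  have swap: "D P (D Q R) - D P (D R Q) - D (bracket Q R) P = bracket P (bracket Q R)"
    if "P \<in> vector_fields A" "Q \<in> vector_fields A" "R \<in> vector_fields A" for P Q R
    using torsion_free[OF that(1) bracket_vector_field[OF that(2,3)]]
      connection_diff[OF that(1) connection(1)[OF that(2,3)] connection(1)[OF that(3,2)]]
    by (simp add: torsion_free[OF that(2,3)])
  show ?thesis
    using swap[OF X Y Z] swap[OF Y Z X] swap[OF Z X Y] Jacobi_identity[OF X Y Z]
    by (simp add: curvature_def algebra_simps)
qed

lemma curvature_swap: "curvature D Y X Z = - curvature D X Y Z"
  if "X \<in> vector_fields A" "Y \<in> vector_fields A" "Z \<in> vector_fields A"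
proof -
  have "bracket Y X = fmul (\<lambda>_. - 1) (bracket X Y)"
    by (auto simp: bracket_def fun_eq_iff)
  then have "D (bracket Y X) Z = - D (bracket X Y) Z"
    using connection(4)[OF bracket_vector_field[OF that(1,2)] that(3) smooth_fun_const[of "- 1"]] by simp
  then show ?thesis
    by (simp add: curvature_def)
qed

text \<open>The operator XY - YX - [X, Y] annihilates the function g(Z, W). When metric
  compatibility expands it, the terms with one derivative on each argument are symmetric in
  \<open>X\<close> and \<open>Y\<close> and cancel; the rest is the claim.\<close>

lemma curvature_skew:
  assumes X: "X \<in> vector_fields A" and Y: "Y \<in> vector_fields A"
    and Z: "Z \<in> vector_fields A" and W: "W \<in> vector_fields A"
  shows "g x (curvature D X Y Z x) (W x) = - g x (Z x) (curvature D X Y W x)"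
proof -
  have second: "P x (\<lambda>y. Q y (\<lambda>z. g z (Z z) (W z))) =
      g x (D P (D Q Z) x) (W x) + g x (D Q Z x) (D P W x)
      + (g x (D P Z x) (D Q W x) + g x (Z x) (D P (D Q W) x))"
    if "P \<in> vector_fields A" "Q \<in> vector_fields A" for P Q
    using that Z W
      tangent_add[OF vector_fields_at[OF that(1)] smooth_metric[OF connection(1)[OF that(2) Z] W]
        smooth_metric[OF Z connection(1)[OF that(2) W]], of x]
    by (simp add: metric_compatible connection(1))
  have "bracket X Y x (\<lambda>z. g z (Z z) (W z)) =
      g x (D (bracket X Y) Z x) (W x) + g x (Z x) (D (bracket X Y) W x)"
    by (rule metric_compatible[OF bracket_vector_field[OF X Y] Z W])
  moreover have "g x (curvature D X Y Z x) (W x) =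
      g x (D X (D Y Z) x) (W x) - g x (D Y (D X Z) x) (W x) - g x (D (bracket X Y) Z x) (W x)"
    using X Y Z W
    by (simp add: curvature_def connection bracket_vector_field vector_fields_at subspace_diff[OF metric.subspace]
        linear_on_set_diff[OF metric.linear_left metric.subspace])
  moreover have "g x (Z x) (curvature D X Y W x) =
      g x (Z x) (D X (D Y W) x) - g x (Z x) (D Y (D X W) x) - g x (Z x) (D (bracket X Y) W x)"
    using X Y Z W
    by (simp add: curvature_def connection bracket_vector_field vector_fields_at subspace_diff[OF metric.subspace]
        linear_on_set_diff[OF metric.linear metric.subspace])
  ultimately show ?thesis
    using second[OF X Y] second[OF Y X] by (simp add: bracket_def)
qed

lemma curvature_at_tangent:
  "u \<in> tangent_space A x \<Longrightarrow> v \<in> tangent_space A x \<Longrightarrow> w \<in> tangent_space A x \<Longrightarrow>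
    curvature_at A D x u v w \<in> tangent_space A x"
  by (simp add: curvature_at_def vector_fields_at curvature_vector_field extend_vec)

text \<open>By the first Bianchi identity, the skew part of the Ricci tensor is the trace of the
  skew-adjoint curvature operator \<open>R(v, w)\<close>.\<close>

lemma ricci_sym:
  assumes v: "v \<in> tangent_space A x" and w: "w \<in> tangent_space A x"
  shows "ricci A D x v w = ricci A D x w v"
proof -
  let ?R = "curvature_at A D x" and ?T = "tangent_space A x"
  have "?R u v w = ?R u w v + - ?R v w u" if u: "u \<in> ?T" for u
  proof -
    note ext = extend_vec(1)[OF u] extend_vec(1)[OF v] extend_vec(1)[OF w]
    have "(curvature D (extend_vec A x u) (extend_vec A x v) (extend_vec A x w)
        + curvature D (extend_vec A x v) (extend_vec A x w) (extend_vec A x u)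
        + curvature D (extend_vec A x w) (extend_vec A x u) (extend_vec A x v)) x = 0"
      by (simp add: Bianchi_identity ext)
    then show ?thesis
      using curvature_swap[OF ext(1,3,2)] by (simp add: curvature_at_def algebra_simps)
  qed
  then have "ricci A D x v w = trace_on ?T (\<lambda>u. ?R u w v + - ?R v w u)"
    unfolding ricci_def by (rule trace_on_cong[OF metric.subspace])
  also have "\<dots> = ricci A D x w v + trace_on ?T (\<lambda>u. - ?R v w u)"
    unfolding ricci_def using v w
    by (intro trace_on_add metric.subspace) (auto intro: curvature_at_tangent subspace_neg[OF metric.subspace])
  also have "trace_on ?T (\<lambda>u. - ?R v w u) = 0"
  proof (rule metric.trace_on_skew[OF finite_tangent_basis])
    show "- ?R v w u \<in> ?T" if "u \<in> ?T" for u
      using that v w by (intro subspace_neg[OF metric.subspace] curvature_at_tangent)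
    show "g x (- ?R v w u) u' = - g x u (- ?R v w u')" if u: "u \<in> ?T" and u': "u' \<in> ?T" for u u'
    proof -
      have "g x (?R v w u) u' = - g x u (?R v w u')"
        using curvature_skew[OF extend_vec(1)[OF v] extend_vec(1)[OF w] extend_vec(1)[OF u] extend_vec(1)[OF u'], of x]
        by (simp add: curvature_at_def extend_vec(2) u u')
      then show ?thesis
        using curvature_at_tangent[OF v w u] curvature_at_tangent[OF v w u'] u u'
          linear_on_set_minus[OF metric.linear_left] linear_on_set_minus[OF metric.linear] by metis
    qed
  qed
  finally show ?thesis by simp
qed

end

section \<open>The SSNM connection of a \<open>K\<close>-contact manifold\<close>

locale K_contact = riemannian_mfd A "2 * n + 1" g D
  for A :: "('a::{t2_space,second_countable_topology}, 'e::euclidean_space) chart set"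
    and n :: nat and g :: "'a bilin_field" and D :: "'a connection" +
  fixes \<phi> :: "'a endo_field" and \<xi> :: "'a vfield" and \<eta> :: "'a one_form"
  assumes K_contact_manifold: "K_contact_manifold A n \<phi> \<xi> \<eta> g"
begin

lemma n_pos: "n \<ge> 1"
  using K_contact_manifold by (simp add: K_contact_manifold_def)

lemma reeb_field: "\<xi> \<in> vector_fields A"
  using K_contact_manifold by (simp add: K_contact_manifold_def)

lemma reeb_at: "\<xi> x \<in> tangent_space A x"
  by (rule vector_fields_at[OF reeb_field])

lemma eta_linear: "linear_on_set (tangent_space A x) (\<eta> x)"
  using K_contact_manifold by (simp add: K_contact_manifold_def is_one_form_def)

lemma smooth_eta: "X \<in> vector_fields A \<Longrightarrow> smooth_fun A (\<lambda>x. \<eta> x (X x))"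
  using K_contact_manifold by (simp add: K_contact_manifold_def is_one_form_def)

lemma phi_linear: "linear_on_set (tangent_space A x) (\<phi> x)"
  using K_contact_manifold by (simp add: K_contact_manifold_def is_endo_field_def)

lemma phi_at: "u \<in> tangent_space A x \<Longrightarrow> \<phi> x u \<in> tangent_space A x"
  using K_contact_manifold by (auto simp: K_contact_manifold_def is_endo_field_def)

lemma phi_phi: "u \<in> tangent_space A x \<Longrightarrow> \<phi> x (\<phi> x u) = - u + \<eta> x u *\<^sub>R \<xi> x"
  using K_contact_manifold by (simp add: K_contact_manifold_def)

lemma eta_reeb [simp]: "\<eta> x (\<xi> x) = 1"
  using K_contact_manifold by (simp add: K_contact_manifold_def)

lemma metric_phi:
  "u \<in> tangent_space A x \<Longrightarrow> v \<in> tangent_space A x \<Longrightarrow>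
    g x (\<phi> x u) (\<phi> x v) = g x u v - \<eta> x u * \<eta> x v"
  using K_contact_manifold by (simp add: K_contact_manifold_def)

lemma ext_deriv_eta:
  "X \<in> vector_fields A \<Longrightarrow> Y \<in> vector_fields A \<Longrightarrow> ext_deriv \<eta> X Y x = g x (X x) (\<phi> x (Y x))"
  using K_contact_manifold by (simp add: K_contact_manifold_def)

lemma reeb_killing:
  "X \<in> vector_fields A \<Longrightarrow> Y \<in> vector_fields A \<Longrightarrow>
    \<xi> x (\<lambda>y. g y (X y) (Y y)) - g x (bracket \<xi> X x) (Y x) - g x (X x) (bracket \<xi> Y x) = 0"
  using K_contact_manifold by (simp add: K_contact_manifold_def killing_def)

text \<open>For u = \<phi> \<xi> the formula for \<phi>^2 gives \<phi> u = 0, hence u = \<eta>(u)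
  \<xi>. Applying \<phi> yields \<eta>(u) u = 0, and the vanishing of either factor forces u =
  0.\<close>

lemma phi_reeb: "\<phi> x (\<xi> x) = 0"
proof -
  let ?u = "\<phi> x (\<xi> x)"
  have u: "?u \<in> tangent_space A x"
    by (rule phi_at[OF reeb_at])
  have phiu: "\<phi> x ?u = 0"
    using phi_phi[OF reeb_at] by simp
  then have "\<phi> x (\<phi> x ?u) = 0"
    using linear_on_set_zero[OF phi_linear reeb_at] by simp
  then have eq: "?u = \<eta> x ?u *\<^sub>R \<xi> x"
    using phi_phi[OF u] by simp
  then have "\<phi> x ?u = \<eta> x ?u *\<^sub>R ?u"
    using linear_on_set_scale[OF phi_linear reeb_at] by metis
  then have "\<eta> x ?u = 0 \<or> ?u = 0"
    using phiu by simp
  then show ?thesis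
    using eq by auto
qed

text \<open>The two ways of evaluating \<phi>^3 u differ by \<eta>(\<phi> u) \<xi>, and \<xi> is
  nonzero.\<close>

lemma eta_phi:
  assumes u: "u \<in> tangent_space A x"
  shows "\<eta> x (\<phi> x u) = 0"
proof -
  have "\<phi> x (\<phi> x (\<phi> x u)) = \<phi> x (- u + \<eta> x u *\<^sub>R \<xi> x)"
    by (simp add: phi_phi[OF u])
  also have "\<dots> = - \<phi> x u"
    using linear_on_set_add[OF phi_linear, of "- u" x "\<eta> x u *\<^sub>R \<xi> x"] u reeb_at
      linear_on_set_minus[OF phi_linear u] linear_on_set_scale[OF phi_linear reeb_at]
      subspace_neg[OF metric.subspace u] subspace_scale[OF metric.subspace reeb_at]
    by (simp add: phi_reeb)
  finally have "\<eta> x (\<phi> x u) *\<^sub>R \<xi> x = 0"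
    using phi_phi[OF phi_at[OF u]] by simp
  moreover have "\<xi> x \<noteq> 0"
    using eta_reeb[of x] linear_on_set_zero[OF eta_linear reeb_at, of x] by (metis zero_neq_one)
  ultimately show ?thesis
    by simp
qed

lemma metric_reeb:
  assumes u: "u \<in> tangent_space A x"
  shows "g x u (\<xi> x) = \<eta> x u"
  using metric_phi[OF u reeb_at] linear_on_set_zero[OF metric.linear[OF phi_at[OF u]] u]
  by (simp add: phi_reeb)

text \<open>The contact condition identifies this value with d\<eta>(X, X) = 0, where
  \<open>X\<close> extends \<open>u\<close>.\<close>

lemma metric_phi_self:
  assumes u: "u \<in> tangent_space A x"
  shows "g x u (\<phi> x u) = 0"
proof -
  let ?X = "extend_vec A x u"
  have "bracket ?X ?X x = 0"
    by (simp add: bracket_def fun_eq_iff)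
  then have "ext_deriv \<eta> ?X ?X x = 0"
    using linear_on_set_zero[OF eta_linear u] by (simp add: ext_deriv_def)
  then show ?thesis
    using ext_deriv_eta[OF extend_vec(1)[OF u] extend_vec(1)[OF u], of x] by (simp add: extend_vec(2)[OF u])
qed

text \<open>The covariant derivative of \<open>\<eta>\<close>: its skew part is \<open>d\<eta>\<close>, its symmetric part vanishes
  since \<open>\<xi>\<close> is Killing.\<close>

lemma covariant_eta:
  assumes X: "X \<in> vector_fields A" and Y: "Y \<in> vector_fields A"
  shows "X x (\<lambda>y. \<eta> y (Y y)) - \<eta> x (D X Y x) = g x (X x) (\<phi> x (Y x))"
proof -
  \<comment> \<open>\<open>c P Q\<close> is the covariant derivative of \<eta> along
    \<open>P\<close>, evaluated on \<open>Q\<close> and expressed through the dual field \<xi>;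
    \<open>deriv\<close> establishes this.\<close>
  define c where "c P Q = g x (Q x) (D P \<xi> x)" for P Q
  have deriv: "P x (\<lambda>y. \<eta> y (Q y)) - \<eta> x (D P Q x) = c P Q"
    if "P \<in> vector_fields A" "Q \<in> vector_fields A" for P Q
  proof -
    have "(\<lambda>y. \<eta> y (Q y)) = (\<lambda>y. g y (Q y) (\<xi> y))"
      using that by (simp add: metric_reeb vector_fields_at)
    then show ?thesis
      using that metric_compatible[OF that reeb_field, of x]
      by (simp add: metric_reeb vector_fields_at connection(1) c_def)
  qed
  have "\<eta> x (bracket X Y x) = \<eta> x (D X Y x) - \<eta> x (D Y X x)"
    using X Y by (simp flip: torsion_free
        add: linear_on_set_diff[OF eta_linear metric.subspace] vector_fields_at connection(1))
  then have "c X Y - c Y X = 2 * g x (X x) (\<phi> x (Y x))"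
    using ext_deriv_eta[OF X Y, of x] deriv[OF X Y] deriv[OF Y X]
    by (simp add: ext_deriv_def)
  moreover have "c X Y + c Y X = 0"
  proof -
    have bracket: "bracket \<xi> P x = D \<xi> P x - D P \<xi> x" if "P \<in> vector_fields A" for P
      by (rule bracket_at[OF reeb_field that])
    have "g x (bracket \<xi> X x) (Y x) = g x (D \<xi> X x) (Y x) - g x (D X \<xi> x) (Y x)"
      using X Y reeb_field
      by (simp add: bracket linear_on_set_diff[OF metric.linear_left metric.subspace]
          vector_fields_at connection(1))
    moreover have "g x (X x) (bracket \<xi> Y x) = g x (X x) (D \<xi> Y x) - g x (X x) (D Y \<xi> x)"
      using X Y reeb_field
      by (simp add: bracket linear_on_set_diff[OF metric.linear metric.subspace]
          vector_fields_at connection(1))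
    moreover have "g x (D X \<xi> x) (Y x) = c X Y"
      unfolding c_def using X Y reeb_field by (intro metric.sym vector_fields_at connection(1))
    ultimately show ?thesis
      using reeb_killing[OF X Y, of x] metric_compatible[OF reeb_field X Y, of x] by (simp add: c_def)
  qed
  ultimately show ?thesis
    using deriv[OF X Y] by simp
qed

section \<open>Curvature, Ricci tensor and scalar curvature of the SSNM connection\<close>

lemma SSNM_curvature:
  assumes X: "X \<in> vector_fields A" and Y: "Y \<in> vector_fields A" and Z: "Z \<in> vector_fields A"
  shows "curvature (SSNM \<eta> D) X Y Z x = curvature D X Y Z x
    + g x (X x) (\<phi> x (Z x)) *\<^sub>R Y x - g x (Y x) (\<phi> x (Z x)) *\<^sub>R X x
    + \<eta> x (Z x) *\<^sub>R (\<eta> x (Y x) *\<^sub>R X x - \<eta> x (X x) *\<^sub>R Y x)"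
proof -
  let ?e = "\<lambda>y. \<eta> y (Z y)"
  \<comment> \<open>After antisymmetrising in \<open>P\<close> and \<open>Q\<close>, the terms with
    \<open>D P Q\<close> cancel against the bracket term, while the derivative of \<open>?e\<close>
    along \<open>P\<close> and \<eta>(D P Z) combine through \<open>covariant_eta\<close> into g(P,
    \<phi> Z).\<close>
  have twice: "SSNM \<eta> D P (SSNM \<eta> D Q Z) x =
      D P (D Q Z) x + \<eta> x (Z x) *\<^sub>R D P Q x + P x ?e *\<^sub>R Q x
      + (\<eta> x (D Q Z x) + \<eta> x (Z x) * \<eta> x (Q x)) *\<^sub>R P x"
    if P: "P \<in> vector_fields A" and Q: "Q \<in> vector_fields A" for P Q
  proof -
    have "D P (D Q Z + fmul ?e Q) = D P (D Q Z) + (fmul ?e (D P Q) + fmul (\<lambda>x. P x ?e) Q)"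
      using connection(3)[OF P connection(1)[OF Q Z] vector_fields_fmul[OF smooth_eta[OF Z] Q]]
        connection(5)[OF P Q smooth_eta[OF Z]] by simp
    moreover have "\<eta> x ((D Q Z + fmul ?e Q) x) = \<eta> x (D Q Z x) + \<eta> x (Z x) * \<eta> x (Q x)"
      using Q Z by (simp add: linear_on_set_add[OF eta_linear] linear_on_set_scale[OF eta_linear]
          vector_fields_at connection(1) subspace_scale[OF metric.subspace])
    ultimately show ?thesis
      by (simp add: SSNM_def add.assoc)
  qed
  have "SSNM \<eta> D (bracket X Y) Z x = D (bracket X Y) Z x + \<eta> x (Z x) *\<^sub>R bracket X Y x"
    by (simp add: SSNM_def)
  moreover have "bracket X Y x = D X Y x - D Y X x"
    by (rule bracket_at[OF X Y])
  moreover have "X x ?e = \<eta> x (D X Z x) + g x (X x) (\<phi> x (Z x))"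
    "Y x ?e = \<eta> x (D Y Z x) + g x (Y x) (\<phi> x (Z x))"
    using covariant_eta[OF X Z, of x] covariant_eta[OF Y Z, of x] by simp_all
  ultimately show ?thesis
    by (simp add: curvature_def twice[OF X Y] twice[OF Y X]
        scaleR_add_left scaleR_diff_left scaleR_add_right scaleR_diff_right)
qed

text \<open>As a function of the traced argument, the additional curvature is a multiple c of the
  identity plus a rank one map. Their traces are (2n + 1) c and - c, hence the factor 2n.\<close>

lemma SSNM_ricci:
  assumes v: "v \<in> tangent_space A x" and w: "w \<in> tangent_space A x"
  shows "ricci A (SSNM \<eta> D) x v w =
    ricci A D x v w - 2 * real n * g x v (\<phi> x w) + 2 * real n * \<eta> x v * \<eta> x w"
proof -
  let ?T = "tangent_space A x" and ?c = "\<eta> x w * \<eta> x v - g x v (\<phi> x w)"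
  let ?k = "\<lambda>u. g x u (\<phi> x w) - \<eta> x w * \<eta> x u"
  note sub = metric.subspace[of x]
  have "curvature_at A (SSNM \<eta> D) x u v w = curvature_at A D x u v w + (?c *\<^sub>R u + ?k u *\<^sub>R v)"
    if u: "u \<in> ?T" for u
    using SSNM_curvature[OF extend_vec(1)[OF u] extend_vec(1)[OF v] extend_vec(1)[OF w], of x]
    by (simp add: curvature_at_def extend_vec(2) u v w algebra_simps)
  then have "ricci A (SSNM \<eta> D) x v w =
      trace_on ?T (\<lambda>u. curvature_at A D x u v w + (?c *\<^sub>R u + ?k u *\<^sub>R v))"
    unfolding ricci_def by (rule trace_on_cong[OF sub])
  also have "\<dots> = ricci A D x v w + (trace_on ?T (\<lambda>u. ?c *\<^sub>R u) + trace_on ?T (\<lambda>u. ?k u *\<^sub>R v))"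
    unfolding ricci_def using v w
    by (subst trace_on_add[OF sub], simp_all add: curvature_at_tangent subspace_add[OF sub] subspace_scale[OF sub])
      (rule trace_on_add[OF sub], simp_all add: subspace_scale[OF sub])
  also have "trace_on ?T (\<lambda>u. ?c *\<^sub>R u) = ?c * real (2 * n + 1)"
    by (rule trace_on_scale[OF sub card_tangent_basis(2)])
  also have "trace_on ?T (\<lambda>u. ?k u *\<^sub>R v) = ?k v"
  proof (rule trace_on_rank_one[OF sub finite_tangent_basis _ v])
    have "g x (a + b) (\<phi> x w) = g x a (\<phi> x w) + g x b (\<phi> x w)" "g x (c *\<^sub>R a) (\<phi> x w) = c * g x a (\<phi> x w)"
      if "a \<in> ?T" "b \<in> ?T" for a b c
      using linear_on_set_add[OF metric.linear_left[OF phi_at[OF w]] that]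
        linear_on_set_scale[OF metric.linear_left[OF phi_at[OF w]] that(1)] by simp_all
    then show "linear_on_set ?T ?k"
      using linear_on_set_add[OF eta_linear] linear_on_set_scale[OF eta_linear]
      unfolding linear_on_set_def[of ?T ?k] by (simp add: algebra_simps)
  qed
  finally show ?thesis
    by (simp add: algebra_simps)
qed

text \<open>On an orthonormal basis the skew terms g(e, \<phi> e) vanish, and the squares
  \<eta>(e)^2 add up to the squared length of \<xi>, which is 1.\<close>

lemma SSNM_scalar_curvature:
  "scalar_curvature A g (SSNM \<eta> D) x = scalar_curvature A g D x + 2 * real n"
proof -
  obtain E where E: "finite E" "E \<subseteq> tangent_space A x" "metric.orthonormal x E"
    "span E = tangent_space A x"
    and trace: "\<forall>b. metric_trace_on (tangent_space A x) (g x) b = (\<Sum>e\<in>E. b e e)"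
    by (rule metric.metric_trace_on_basis[of x, OF finite_tangent_basis])
  have "ricci A (SSNM \<eta> D) x e e = ricci A D x e e + 2 * real n * (\<eta> x e * \<eta> x e)" if "e \<in> E" for e
    using E(2) that by (auto simp: SSNM_ricci metric_phi_self)
  then have "scalar_curvature A g (SSNM \<eta> D) x =
      scalar_curvature A g D x + 2 * real n * (\<Sum>e\<in>E. \<eta> x e * \<eta> x e)"
    by (simp add: scalar_curvature_def trace sum.distrib sum_distrib_left)
  moreover have "(\<Sum>e\<in>E. \<eta> x e * \<eta> x e) = 1"
  proof -
    have eta: "g x (\<xi> x) e = \<eta> x e" if "e \<in> E" for e
      using that E(2) metric_reeb metric.sym[OF reeb_at] by (metis subset_iff)
    have "1 = \<eta> x (\<Sum>e\<in>E. g x (\<xi> x) e *\<^sub>R e)"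
      using metric.orthonormal_expansion[OF E(1,3,4) reeb_at] eta_reeb[of x] by simp
    also have "\<dots> = (\<Sum>e\<in>E. \<eta> x (g x (\<xi> x) e *\<^sub>R e))"
      using E(2) by (intro linear_on_set_sum[OF eta_linear metric.subspace] subspace_scale[OF metric.subspace]) auto
    also have "\<dots> = (\<Sum>e\<in>E. \<eta> x e * \<eta> x e)"
      using E(2) by (intro sum.cong) (auto simp: eta linear_on_set_scale[OF eta_linear])
    finally show ?thesis by simp
  qed
  ultimately show ?thesis by simp
qed

text \<open>As 2n + 1 > 1, some basis vector is not a multiple of \<xi>; removing its
  \<xi>-component leaves a nonzero vector of the contact distribution.\<close>

lemma horizontal_vector:
  obtains e where "e \<in> tangent_space A x" "\<eta> x e = 0" "g x e e > 0"
proof -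
  obtain B where B: "finite B" "independent B" "span B = tangent_space A x" "card B = 2 * n + 1"
    using tangent_space_basis by metis
  have "\<not> B \<subseteq> span {\<xi> x}"
    using independent_span_bound[of "{\<xi> x}" B] B n_pos by auto
  then obtain u where u: "u \<in> B" "u \<notin> span {\<xi> x}"
    by auto
  then have uT: "u \<in> tangent_space A x"
    using B(3) span_base by blast
  let ?e = "u - \<eta> x u *\<^sub>R \<xi> x"
  have scaled: "\<eta> x u *\<^sub>R \<xi> x \<in> tangent_space A x"
    by (rule subspace_scale[OF metric.subspace reeb_at])
  have e: "?e \<in> tangent_space A x"
    by (rule subspace_diff[OF metric.subspace uT scaled])
  moreover have "\<eta> x ?e = 0"
    using linear_on_set_diff[OF eta_linear metric.subspace uT scaled] linear_on_set_scale[OF eta_linear reeb_at]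
    by simp
  moreover have "?e \<noteq> 0"
    using u(2) by (auto simp: span_singleton)
  ultimately show ?thesis
    using that[of ?e] metric.pos by blast
qed

section \<open>The soliton equation at a point and the degeneracy it forces\<close>

lemma soliton_equation:
  assumes soliton: "conformal_eta_Ricci_Yamabe_soliton A n g \<eta> (SSNM \<eta> D) V lam \<alpha> \<beta> \<gamma> p"
    and torse: "torse_forming A \<eta> (SSNM \<eta> D) V \<mu> \<psi>"
    and u: "u \<in> tangent_space A x" and v: "v \<in> tangent_space A x"
  shows "\<psi> x u * g x (V x) v + \<psi> x v * g x (V x) u
    + (2 * \<mu> x + 2 * lam - \<beta> * (scalar_curvature A g D x + 2 * real n) - (p x + 2 / (2 * real n + 1))) * g x u v
    + 2 * \<alpha> * (ricci A D x u v - 2 * real n * g x u (\<phi> x v) + 2 * real n * \<eta> x u * \<eta> x v)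
    + 2 * \<gamma> * (\<eta> x u * \<eta> x v) = 0"
proof -
  let ?X = "extend_vec A x u" and ?Y = "extend_vec A x v"
  note X = extend_vec(1)[OF u] and Y = extend_vec(1)[OF v]
  have V: "V \<in> vector_fields A"
    using torse by (simp add: torse_forming_def)
  have lie: "lie_field (SSNM \<eta> D) V Z = bracket V Z" for Z
    by (simp add: lie_field_def torsion_def)
  have bracket: "bracket V Z x = D V Z x - (\<mu> x *\<^sub>R Z x + \<psi> x (Z x) *\<^sub>R V x)"
    if Z: "Z \<in> vector_fields A" for Z
  proof -
    have "SSNM \<eta> D Z V x = (fmul \<mu> Z + fmul (\<lambda>x. \<psi> x (Z x)) V + fmul (\<lambda>x. \<eta> x (V x)) Z) x"
      using torse Z by (simp add: torse_forming_def)
    \<comment> \<open>The summand \<eta>(V) Z of the torse-forming condition is exactly the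
      difference between the two connections, so it cancels.\<close>
    then have "D Z V x = \<mu> x *\<^sub>R Z x + \<psi> x (Z x) *\<^sub>R V x"
      by (simp add: SSNM_def)
    moreover have "bracket V Z x = D V Z x - D Z V x"
      by (rule bracket_at[OF V Z])
    ultimately show ?thesis by simp
  qed
  have tangent: "V x \<in> tangent_space A x" "D V ?X x \<in> tangent_space A x" "D V ?Y x \<in> tangent_space A x"
    using V X Y by (simp_all add: vector_fields_at connection(1))
  note sub = metric.subspace subspace_add[OF metric.subspace] subspace_scale[OF metric.subspace]
  have "g x (bracket V ?X x) v = g x (D V ?X x) v - (\<mu> x * g x u v + \<psi> x u * g x (V x) v)"
    using u v tangent
    by (simp add: bracket[OF X] extend_vec(2) sub linear_on_set_diff[OF metric.linear_left]
        linear_on_set_add[OF metric.linear_left] linear_on_set_scale[OF metric.linear_left])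
  moreover have "g x u (bracket V ?Y x) = g x u (D V ?Y x) - (\<mu> x * g x u v + \<psi> x v * g x (V x) u)"
    using u v tangent metric.sym[OF u tangent(1)]
    by (simp add: bracket[OF Y] extend_vec(2) sub linear_on_set_diff[OF metric.linear]
        linear_on_set_add[OF metric.linear] linear_on_set_scale[OF metric.linear])
  moreover have "V x (\<lambda>y. g y (?X y) (?Y y)) = g x (D V ?X x) v + g x u (D V ?Y x)"
    using metric_compatible[OF V X Y, of x] by (simp add: extend_vec(2) u v)
  ultimately have "lie_metric (SSNM \<eta> D) g V ?X ?Y x =
      2 * \<mu> x * g x u v + \<psi> x u * g x (V x) v + \<psi> x v * g x (V x) u"
    by (simp add: lie_metric_def lie extend_vec(2) u v)
  moreover have "lie_metric (SSNM \<eta> D) g V ?X ?Y x + 2 * \<alpha> * ricci A (SSNM \<eta> D) x (?X x) (?Y x)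
        + (2 * lam - \<beta> * scalar_curvature A g (SSNM \<eta> D) x - (p x + 2 / (2 * real n + 1))) * g x (?X x) (?Y x)
        + 2 * \<gamma> * (\<eta> x (?X x) * \<eta> x (?Y x)) = 0"
    using soliton X Y by (simp add: conformal_eta_Ricci_Yamabe_soliton_def)
  ultimately show ?thesis
    by (simp add: extend_vec(2) u v SSNM_ricci SSNM_scalar_curvature algebra_simps)
qed

text \<open>The only nonsymmetric term of the soliton equation comes from \<open>\<alpha>\<close> times the skew part
  \<open>g(u, \<phi>v)\<close> of the Ricci tensor.\<close>

lemma soliton_alpha_eq_0:
  assumes "conformal_eta_Ricci_Yamabe_soliton A n g \<eta> (SSNM \<eta> D) V lam \<alpha> \<beta> \<gamma> p"
    and "torse_forming A \<eta> (SSNM \<eta> D) V \<mu> \<psi>"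
  shows "\<alpha> = 0"
proof -
  fix x :: 'a
  obtain e where e: "e \<in> tangent_space A x" "\<eta> x e = 0" "g x e e > 0"
    by (rule horizontal_vector)
  let ?f = "\<phi> x e"
  have f: "?f \<in> tangent_space A x" "\<eta> x ?f = 0"
    using e by (simp_all add: phi_at eta_phi)
  have metric_f: "g x e (\<phi> x ?f) = - g x e e" "g x ?f ?f = g x e e" "g x ?f e = g x e ?f"
    using e f by (simp_all add: phi_phi metric_phi linear_on_set_minus[OF metric.linear] metric.sym)
  \<comment> \<open>\<open>?s\<close> is symmetric in \<open>e\<close> and \<phi> e. The remaining
    \<alpha>-terms have opposite signs for the two orders, because g(e, \<phi> \<phi> e) = - g(e, e)
    but g(\<phi> e, \<phi> e) = g(e, e).\<close>
  let ?s = "\<psi> x e * g x (V x) ?f + \<psi> x ?f * g x (V x) e + 2 * \<alpha> * ricci A D x e ?f"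
  have "?s + 4 * (\<alpha> * (real n * g x e e)) = 0"
    using soliton_equation[OF assms e(1) f(1)]
    by (simp add: e f metric_f metric_phi_self algebra_simps)
  moreover have "?s - 4 * (\<alpha> * (real n * g x e e)) = 0"
    using soliton_equation[OF assms f(1) e(1)]
    by (simp add: e f metric_f metric_phi_self ricci_sym[OF f(1) e(1)] algebra_simps)
  ultimately have "\<alpha> * (real n * g x e e) = 0"
    by linarith
  then show ?thesis
    using e(3) n_pos by simp
qed

text \<open>Let a, b be the values of \<psi> and g(V, .) on a horizontal e, and c, d those on \<phi>
  e. The equation at three pairs gives 2ab = 2cd = - q g(e, e) and ad = - cb. So (q g(e, e))^2 = 4
  (ad)(cb) = - 4 (cb)^2, which forces q = 0.\<close>

lemma soliton_conformal_factor_eq_0: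
  assumes soliton: "conformal_eta_Ricci_Yamabe_soliton A n g \<eta> (SSNM \<eta> D) V lam \<alpha> \<beta> \<gamma> p"
    and torse: "torse_forming A \<eta> (SSNM \<eta> D) V \<mu> \<psi>"
  shows "2 * \<mu> x + 2 * lam - \<beta> * (scalar_curvature A g D x + 2 * real n) - (p x + 2 / (2 * real n + 1)) = 0"
    (is "?q = 0")
proof -
  obtain e where e: "e \<in> tangent_space A x" "\<eta> x e = 0" "g x e e > 0"
    by (rule horizontal_vector)
  let ?f = "\<phi> x e"
  have f: "?f \<in> tangent_space A x" "\<eta> x ?f = 0"
    using e by (simp_all add: phi_at eta_phi)
  note eq = soliton_equation[OF assms, unfolded soliton_alpha_eq_0[OF assms]]
  let ?a = "\<psi> x e" and ?b = "g x (V x) e" and ?c = "\<psi> x ?f" and ?d = "g x (V x) ?f"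
  have 1: "2 * (?a * ?b) = - (?q * g x e e)"
    using eq[OF e(1) e(1)] by (simp add: e)
  have 2: "2 * (?c * ?d) = - (?q * g x e e)"
    using eq[OF f(1) f(1)] metric_phi[OF e(1) e(1)] by (simp add: e f)
  have 3: "?a * ?d = - (?c * ?b)"
    using eq[OF e(1) f(1)] by (simp add: e f metric_phi_self)
  have "(?q * g x e e)\<^sup>2 = (2 * (?a * ?b)) * (2 * (?c * ?d))"
    by (simp add: 1 2 power2_eq_square)
  also have "\<dots> = 4 * ((?a * ?d) * (?c * ?b))"
    by simp
  also have "\<dots> = - 4 * (?c * ?b)\<^sup>2"
    by (simp add: 3 power2_eq_square)
  finally have "(?q * g x e e)\<^sup>2 \<le> 0"
    by simp
  then have "?q * g x e e = 0"
    by simp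
  then show ?thesis
    using e(3) by simp
qed

text \<open>If \<open>\<gamma>\<close> did not vanish, \<open>V\<close> would be a nowhere zero multiple \<open>h \<xi>\<close> of the Reeb field. Then
  the exterior derivative of \<open>g(V, \<cdot>) = h \<eta>\<close> is \<open>h d\<eta>\<close> on the contact distribution, while the
  torse-forming condition makes it \<open>\<psi> \<and> h \<eta>\<close>, which vanishes there.\<close>

lemma soliton_gamma_eq_0:
  assumes soliton: "conformal_eta_Ricci_Yamabe_soliton A n g \<eta> (SSNM \<eta> D) V lam \<alpha> \<beta> \<gamma> p"
    and torse: "torse_forming A \<eta> (SSNM \<eta> D) V \<mu> \<psi>"
  shows "\<gamma> = 0" and "\<psi> x (\<xi> x) * \<eta> x (V x) = 0"
proof -
  have V: "V \<in> vector_fields A"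
    using torse by (simp add: torse_forming_def)
  note Vx = vector_fields_at[OF V]
  have eq: "\<psi> x u * g x (V x) v + \<psi> x v * g x (V x) u + 2 * \<gamma> * (\<eta> x u * \<eta> x v) = 0"
    if "u \<in> tangent_space A x" "v \<in> tangent_space A x" for u v x
    using soliton_equation[OF assms that]
    unfolding soliton_alpha_eq_0[OF assms] soliton_conformal_factor_eq_0[OF assms] by simp
  have reeb: "\<psi> x (\<xi> x) * \<eta> x (V x) = - \<gamma>" for x
    using eq[OF reeb_at[of x] reeb_at[of x]] unfolding metric_reeb[OF Vx] eta_reeb by linarith
  show "\<gamma> = 0"
  proof (rule ccontr)
    assume "\<gamma> \<noteq> 0"
    then have nz: "\<psi> x (\<xi> x) \<noteq> 0" "\<eta> x (V x) \<noteq> 0" for x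
      using reeb[of x] by auto
    \<comment> \<open>At (e, e) one of the factors \<psi>(e), g(V, e) vanishes; at (e, \<xi>) they
      enter a vanishing sum with nonzero coefficients, so both vanish.\<close>
    have horizontal: "g x (V x) e = 0" if e: "e \<in> tangent_space A x" "\<eta> x e = 0" for x e
    proof -
      have "\<psi> x e * g x (V x) e = 0"
        using eq[OF e(1) e(1)] e(2) by simp
      moreover have "\<psi> x e * \<eta> x (V x) + \<psi> x (\<xi> x) * g x (V x) e = 0"
        using eq[OF e(1) reeb_at] e(2) by (simp add: metric_reeb[OF Vx])
      ultimately show ?thesis
        using nz[of x] by auto
    qed
    \<comment> \<open>Splitting \<open>u\<close> into its \<xi>-component and a horizontal part
      shows that the 1-form dual to \<open>V\<close> is \<eta>(V) \<eta>.\<close>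
    have vertical: "g x (V x) u = \<eta> x (V x) * \<eta> x u" if u: "u \<in> tangent_space A x" for x u
    proof -
      have scaled: "\<eta> x u *\<^sub>R \<xi> x \<in> tangent_space A x"
        by (rule subspace_scale[OF metric.subspace reeb_at])
      have "\<eta> x (u - \<eta> x u *\<^sub>R \<xi> x) = 0"
        using linear_on_set_diff[OF eta_linear metric.subspace u scaled]
          linear_on_set_scale[OF eta_linear reeb_at] by simp
      then have "g x (V x) (u - \<eta> x u *\<^sub>R \<xi> x) = 0"
        by (intro horizontal subspace_diff[OF metric.subspace u scaled])
      then show ?thesis
        using linear_on_set_diff[OF metric.linear[OF Vx] metric.subspace u scaled]
          linear_on_set_scale[OF metric.linear[OF Vx] reeb_at]
        by (simp add: metric_reeb[OF Vx])
    qed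
    fix x :: 'a
    obtain e where e: "e \<in> tangent_space A x" "\<eta> x e = 0" "g x e e > 0"
      by (rule horizontal_vector)
    have f: "\<phi> x e \<in> tangent_space A x" "\<eta> x (\<phi> x e) = 0"
      using e by (simp_all add: phi_at eta_phi)
    let ?X = "extend_vec A x e" and ?Y = "extend_vec A x (\<phi> x e)"
    note X = extend_vec(1)[OF e(1)] and Y = extend_vec(1)[OF f(1)]
    \<comment> \<open>The product rule also differentiates the factor \<eta>(V), but that term
      carries \<eta>(Q), which is 0 at \<open>x\<close>.\<close>
    have V_form: "P x (\<lambda>y. g y (V y) (Q y)) = \<eta> x (V x) * P x (\<lambda>y. \<eta> y (Q y))"
      if P: "P \<in> vector_fields A" and Q: "Q \<in> vector_fields A" and "\<eta> x (Q x) = 0" for P Q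
    proof -
      have "(\<lambda>y. g y (V y) (Q y)) = (\<lambda>y. \<eta> y (V y) * \<eta> y (Q y))"
        using vertical vector_fields_at[OF Q] by blast
      then show ?thesis
        using tangent_mult[OF vector_fields_at[OF P] smooth_eta[OF V] smooth_eta[OF Q], of x] that(3) by simp
    qed
    have DV: "g x (D P V x) w = \<mu> x * g x (P x) w + \<psi> x (P x) * g x (V x) w"
      if P: "P \<in> vector_fields A" and w: "w \<in> tangent_space A x" for P w
    proof -
      have "SSNM \<eta> D P V x = (fmul \<mu> P + fmul (\<lambda>x. \<psi> x (P x)) V + fmul (\<lambda>x. \<eta> x (V x)) P) x"
        using torse P by (simp add: torse_forming_def)
      then have "D P V x = \<mu> x *\<^sub>R P x + \<psi> x (P x) *\<^sub>R V x"
        by (simp add: SSNM_def)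
      then show ?thesis
        using P w Vx by (simp add: vector_fields_at subspace_scale[OF metric.subspace]
            linear_on_set_add[OF metric.linear_left] linear_on_set_scale[OF metric.linear_left])
    qed
    have Vef: "g x (V x) e = 0" "g x (V x) (\<phi> x e) = 0"
      using horizontal e f by simp_all
    have bracket: "bracket ?X ?Y x = D ?X ?Y x - D ?Y ?X x"
      by (rule bracket_at[OF X Y])
    have tangent: "D ?X ?Y x \<in> tangent_space A x" "D ?Y ?X x \<in> tangent_space A x"
      using X Y by (simp_all add: vector_fields_at connection(1))
    \<comment> \<open>Up to the factor 2, this is the exterior derivative of the dual form of
      \<open>V\<close> on e and \<phi> e: on the left with \<eta>(V) pulled out, on the right
      through the metric.\<close>
    have "\<eta> x (V x) * (?X x (\<lambda>y. \<eta> y (?Y y)) - ?Y x (\<lambda>y. \<eta> y (?X y)) - \<eta> x (bracket ?X ?Y x)) =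
        ?X x (\<lambda>y. g y (V y) (?Y y)) - ?Y x (\<lambda>y. g y (V y) (?X y)) - g x (V x) (bracket ?X ?Y x)"
    proof -
      have "\<eta> x (?Y x) = 0" "\<eta> x (?X x) = 0"
        by (simp_all add: extend_vec(2) e f)
      then show ?thesis
        by (simp only: V_form[OF X Y] V_form[OF Y X] right_diff_distrib
            vertical[OF vector_fields_at[OF bracket_vector_field[OF X Y]]])
    qed
    also have "\<dots> = g x (D ?X V x) (\<phi> x e) - g x (D ?Y V x) e"
      using metric_compatible[OF X V Y, of x] metric_compatible[OF Y V X, of x] tangent
      by (simp add: bracket linear_on_set_diff[OF metric.linear[OF Vx] metric.subspace] extend_vec(2) e f)
    \<comment> \<open>The \<mu>-terms cancel by symmetry of the metric; the \<psi>-terms vanish as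
      \<open>V\<close> is orthogonal to e and \<phi> e.\<close>
    also have "\<dots> = 0"
      using DV[OF X f(1)] DV[OF Y e(1)] metric.sym[OF e(1) f(1)] by (simp add: extend_vec(2) e f Vef)
    finally have "?X x (\<lambda>y. \<eta> y (?Y y)) - ?Y x (\<lambda>y. \<eta> y (?X y)) - \<eta> x (bracket ?X ?Y x) = 0"
      using nz by simp
    \<comment> \<open>The contact condition turns the vanishing of d\<eta>(e, \<phi> e) into g(e,
      \<phi> \<phi> e) = 0, whereas this value is - g(e, e) < 0.\<close>
    then have "g x e (\<phi> x (\<phi> x e)) = 0"
      using ext_deriv_eta[OF X Y, of x] by (simp add: ext_deriv_def extend_vec(2) e f)
    then show False
      using e by (simp add: phi_phi linear_on_set_minus[OF metric.linear])
  qed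
  then show "\<psi> x (\<xi> x) * \<eta> x (V x) = 0"
    using reeb by simp
qed

end

theorem theorem4p8:
  fixes A :: "('a::{t2_space,second_countable_topology}, 'e::euclidean_space) chart set"
    and n :: nat
    and \<phi> :: "'a endo_field" and \<xi> :: "'a vfield" and \<eta> :: "'a one_form" and g :: "'a bilin_field"
    and D :: "'a connection"
    and V :: "'a vfield" and lam \<alpha> \<beta> \<gamma> :: real and p :: "'a \<Rightarrow> real"
    and \<mu> :: "'a \<Rightarrow> real" and \<psi> :: "'a one_form"
    and r :: "'a \<Rightarrow> real"
  assumes "K_contact_manifold A n \<phi> \<xi> \<eta> g"
    and "levi_civita A g D"
    and "r = scalar_curvature A g D"
    and "conformal_eta_Ricci_Yamabe_soliton A n g \<eta> (SSNM \<eta> D) V lam \<alpha> \<beta> \<gamma> p"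
    and "torse_forming A \<eta> (SSNM \<eta> D) V \<mu> \<psi>"
  shows "\<forall>x.
    lam = \<gamma> - \<mu> x - \<psi> x (\<xi> x) * \<eta> x (V x) - 4 * real n * \<alpha>
          + 1 / 2 * (\<beta> * (r x + 2 * real n) + (p x + 2 / (2 * real n + 1))) \<and>
    (\<gamma> + 1 / 2 * (\<beta> * (r x + 2 * real n) + (p x + 2 / (2 * real n + 1)))
       < \<mu> x + \<psi> x (\<xi> x) * \<eta> x (V x) + 4 * real n * \<alpha> \<longrightarrow> shrinking lam) \<and>
    (\<gamma> + 1 / 2 * (\<beta> * (r x + 2 * real n) + (p x + 2 / (2 * real n + 1)))
       = \<mu> x + \<psi> x (\<xi> x) * \<eta> x (V x) + 4 * real n * \<alpha> \<longrightarrow> steady lam) \<and>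
    (\<gamma> + 1 / 2 * (\<beta> * (r x + 2 * real n) + (p x + 2 / (2 * real n + 1)))
       > \<mu> x + \<psi> x (\<xi> x) * \<eta> x (V x) + 4 * real n * \<alpha> \<longrightarrow> expanding lam)"
proof (rule allI, goal_cases)
  case (1 x)
  interpret K_contact A n g D \<phi> \<xi> \<eta>
    using assms(1,2) by unfold_locales (auto simp: K_contact_manifold_def)
  note zero = soliton_alpha_eq_0[OF assms(4,5)] soliton_gamma_eq_0(1)[OF assms(4,5)]
    soliton_gamma_eq_0(2)[OF assms(4,5), of x]
  \<comment> \<open>With the vanishing quantities removed, each sign condition compares
    \<open>s\<close> with \<mu>, and \<open>lam\<close> is their difference.\<close>
  define s where "s = 1 / 2 * (\<beta> * (r x + 2 * real n) + (p x + 2 / (2 * real n + 1)))"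
  have "lam = s - \<mu> x"
    using soliton_conformal_factor_eq_0[OF assms(4,5), of x] unfolding s_def assms(3) by argo
  then show ?case
    unfolding zero shrinking_def steady_def expanding_def s_def[symmetric] by simp
qed

end
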